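(* Let $f:\mathbb{R}^{n}\to\mathbb{R}$ be a smooth function and let $M\subset\mathbb{R}^{n}$ be a smooth submanifold. Then the set $$A(f,M)=\{a\in\mathbb{R}^{n}\mid (f+q_{a})|_{M}\ \text{is Morse}\}$$ is residual in $\mathbb{R}^{n}$.
   Context: For $a=(a_{1},\ldots,a_{n})\in\mathbb{R}^{n}$, the function $q_{a}:\mathbb{R}^{n}\to\mathbb{R}$ is defined by $q_{a}(x)=a_{1}x_{1}^{2}+\cdots+a_{n}x_{n}^{2}$. Smooth means $C^{\infty}$. A smooth function on a manifold is Morse if all of its critical points are nondegenerate (the Hessian at each critical point is nonsingular). A subset of $\mathbb{R}^{n}$ is residual if it contains a countable intersection of open dense subsets of $\mathbb{R}^{n}$. *)

theory Defs
  imports "HOL-Analysis.Analysis"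
begin

definition quad_form :: "real ^ 'n \<Rightarrow> real ^ 'n \<Rightarrow> real" where
  "quad_form a x = (\<Sum>i\<in>UNIV. a $ i * (x $ i)\<^sup>2)"

(* Iterated Frechet derivatives, evaluated at a fixed direction in each step. The notion is
   meant for open S; the codomain is finite-dimensional, so it agrees with the usual C^k. *)
primrec C_on :: "nat \<Rightarrow> 'a::euclidean_space set \<Rightarrow> ('a \<Rightarrow> 'b::euclidean_space) \<Rightarrow> bool" where
  "C_on 0 S f \<longleftrightarrow> continuous_on S f"
| "C_on (Suc k) S f \<longleftrightarrow>
     (\<forall>x\<in>S. f differentiable (at x)) \<and> (\<forall>v. C_on k S (\<lambda>x. frechet_derivative f (at x) v))"

definition smooth_on :: "'a::euclidean_space set \<Rightarrow> ('a \<Rightarrow> 'b::euclidean_space) \<Rightarrow> bool" where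
  "smooth_on S f \<longleftrightarrow> (\<forall>k. C_on k S f)"

(* The copy of R^K in R^n, for a set K of coordinates. *)
definition coord_subspace :: "'n::finite set \<Rightarrow> (real ^ 'n) set" where
  "coord_subspace K = {y. \<forall>i. i \<notin> K \<longrightarrow> y $ i = 0}"

(* phi : U \<rightarrow> V is a diffeomorphism of open sets, with inverse psi, that flattens M \<inter> U.
   The functions phi and psi are unconstrained outside U and V. *)
definition slice_chart ::
  "(real ^ 'n) set \<Rightarrow> 'n::finite set \<Rightarrow> (real ^ 'n) set \<Rightarrow> (real ^ 'n) set \<Rightarrow>
    (real ^ 'n \<Rightarrow> real ^ 'n) \<Rightarrow> (real ^ 'n \<Rightarrow> real ^ 'n) \<Rightarrow> bool" where
  "slice_chart M K U V \<phi> \<psi> \<longleftrightarrow>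
     open U \<and> open V \<and> homeomorphism U V \<phi> \<psi> \<and> smooth_on U \<phi> \<and> smooth_on V \<psi> \<and>
     \<phi> ` (M \<inter> U) = V \<inter> coord_subspace K"

(* Embedded, without boundary, of constant dimension; the empty set is allowed. *)
definition smooth_submanifold :: "(real ^ 'n::finite) set \<Rightarrow> bool" where
  "smooth_submanifold M \<longleftrightarrow>
     (\<exists>k. \<forall>p\<in>M. \<exists>K U V \<phi> \<psi>. card K = k \<and> p \<in> U \<and> slice_chart M K U V \<phi> \<psi>)"

definition smooth_on_submanifold :: "(real ^ 'n::finite) set \<Rightarrow> (real ^ 'n \<Rightarrow> real) \<Rightarrow> bool" where
  "smooth_on_submanifold M g \<longleftrightarrow>
     (\<forall>p\<in>M. \<exists>U G. open U \<and> p \<in> U \<and> smooth_on U G \<and> (\<forall>x\<in>M \<inter> U. G x = g x))"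

definition partial_deriv :: "'n::finite \<Rightarrow> (real ^ 'n \<Rightarrow> real) \<Rightarrow> real ^ 'n \<Rightarrow> real" where
  "partial_deriv i h y = deriv (\<lambda>t. h (y + t *\<^sub>R axis i 1)) 0"

(* For y in coord_subspace K, the next two notions differentiate only along coord_subspace K,
   so they depend only on the restriction of h to coord_subspace K near y. *)
definition critical_point :: "'n::finite set \<Rightarrow> (real ^ 'n \<Rightarrow> real) \<Rightarrow> real ^ 'n \<Rightarrow> bool" where
  "critical_point K h y \<longleftrightarrow> (\<forall>i\<in>K. partial_deriv i h y = 0)"

(* The K \<times> K Hessian matrix has trivial kernel. *)
definition nonsingular_Hessian :: "'n::finite set \<Rightarrow> (real ^ 'n \<Rightarrow> real) \<Rightarrow> real ^ 'n \<Rightarrow> bool" where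
  "nonsingular_Hessian K h y \<longleftrightarrow>
     (\<forall>v\<in>coord_subspace K.
        (\<forall>i\<in>K. (\<Sum>j\<in>K. partial_deriv i (partial_deriv j h) y * v $ j) = 0) \<longrightarrow> v = 0)"

(* The restriction of g to M is Morse; values of g outside M do not matter. In the chart phi
   with inverse psi, the restriction of g to M is represented by g \<circ> psi on
   V \<inter> coord_subspace K. *)
definition Morse_on :: "(real ^ 'n::finite) set \<Rightarrow> (real ^ 'n \<Rightarrow> real) \<Rightarrow> bool" where
  "Morse_on M g \<longleftrightarrow>
     smooth_on_submanifold M g \<and>
     (\<forall>p\<in>M. \<forall>K U V \<phi> \<psi>. p \<in> U \<and> slice_chart M K U V \<phi> \<psi> \<and> critical_point K (g \<circ> \<psi>) (\<phi> p)
        \<longrightarrow> nonsingular_Hessian K (g \<circ> \<psi>) (\<phi> p))"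

definition residual :: "'a::topological_space set \<Rightarrow> bool" where
  "residual A \<longleftrightarrow>
     (\<exists>\<G>. countable \<G> \<and> (\<forall>G\<in>\<G>. open G \<and> closure G = UNIV) \<and> \<Inter>\<G> \<subseteq> A)"

end

theory Submission
  imports Defs
begin

text \<open>
  A parameter \<open>a\<close> is bad if \<open>f + q\<^sub>a\<close> has a degenerate critical point on \<open>M\<close>. Countably many compact
  pieces of charts cover \<open>M\<close> (Lindelof), so it suffices to show that the parameters that are bad
  because of one compact piece form a closed Lebesgue null set; its complement is then open and dense.
  The set is closed because it is the projection, along a compact set, of a closed set of pairs of a
  point and a parameter (\<open>closed_degenerate_params\<close>).

  The usual transversality argument does not give that the set is null: where coordinates of a point
  vanish, the differential of \<open>q\<^sub>a\<close> does not vary enough with \<open>a\<close> to fill the cotangent space. The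
  argument used instead works in charts of \<open>M\<close> whose coordinates are some of the ambient coordinates
  \<open>x\<^sub>l\<close>, \<open>l \<in> L\<close> (\<open>coordinate_slice_chart\<close>). There the \<open>l\<close>-th partial derivative of \<open>f + q\<^sub>a\<close> is a function
  of the point and of the \<open>a\<^sub>i\<close> with \<open>i \<notin> L\<close>, plus \<open>2 a\<^sub>l x\<^sub>l\<close>. The points are sorted by the set \<open>I \<subseteq> L\<close> of
  chart coordinates that vanish; let \<open>J = L - I\<close>. For \<open>j \<in> J\<close>, the critical point equation determines
  \<open>a\<^sub>j\<close>. This yields a map \<open>\<Psi>\<close> from an open subset of \<open>\<real>\<^sup>n\<close> to the parameter space, from \<open>x\<^sub>j\<close> (\<open>j \<in> J\<close>) and \<open>a\<^sub>i\<close>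
  (\<open>i \<notin> J\<close>) to \<open>a\<close>, whose image contains all parameters with a critical point of this type. If the
  \<open>J \<times> J\<close> block of the Hessian is singular, then so is the derivative of \<open>\<Psi>\<close>, and Sard's theorem in equal
  dimensions applies. If the block is nonsingular, then the determinant of the full Hessian is a
  nonzero polynomial in the common increment of the \<open>a\<^sub>i\<close> with \<open>i \<in> I\<close>, on which \<open>x\<close>, the \<open>J \<times> J\<close> block and
  the remaining part of \<open>\<Psi>\<close> do not depend; so its zeros form a null set, which \<open>\<Psi>\<close> maps to a null set
  (\<open>negligible_stratum\<close>).

  The Morse condition refers to all slice charts at a point. Nondegeneracy of a critical point does
  not depend on the chart (\<open>nondegenerate_chart_change\<close>), so one chart from the countable cover suffices.
\<close>

section \<open>Calculus of iterated Frechet derivatives\<close>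

lemma C_on_cong:
  assumes "open S" "\<And>x. x \<in> S \<Longrightarrow> f x = g x"
  shows "C_on k S f \<longleftrightarrow> C_on k S g"
  using assms(2)
proof (induction k arbitrary: f g)
  case 0
  then show ?case by (simp cong: continuous_on_cong)
next
  case (Suc k)
  have *: "(f has_derivative D) (at x) \<longleftrightarrow> (g has_derivative D) (at x)" if "x \<in> S" for D x
    using has_derivative_transform_within_open[OF _ \<open>open S\<close> that] Suc.prems by metis
  then have "f differentiable (at x) \<longleftrightarrow> g differentiable (at x)" if "x \<in> S" for x
    using that by (simp add: differentiable_def)
  moreover have "frechet_derivative f (at x) v = frechet_derivative g (at x) v" if "x \<in> S" for x v
    using * that by (simp add: frechet_derivative_def)
  then have "C_on k S (\<lambda>x. frechet_derivative f (at x) v) \<longleftrightarrow>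
      C_on k S (\<lambda>x. frechet_derivative g (at x) v)" for v
    by (intro Suc.IH)
  ultimately show ?case by simp
qed

lemma C_on_subset: "C_on k S f \<Longrightarrow> T \<subseteq> S \<Longrightarrow> C_on k T f"
  by (induction k arbitrary: f) (auto intro: continuous_on_subset)

text \<open>
  Any family of derivatives that is valid on the open set \<open>S\<close> may replace the Frechet derivative
  in the recursion for \<^const>\<open>C_on\<close>; the closure properties below rest on this rule.
\<close>

lemma C_on_SucI:
  assumes "open S" "\<And>x. x \<in> S \<Longrightarrow> (f has_derivative f' x) (at x)"
    and "\<And>v. C_on k S (\<lambda>x. f' x v)"
  shows "C_on (Suc k) S f"
proof -
  have "C_on k S (\<lambda>x. frechet_derivative f (at x) v)" for v
    using assms C_on_cong[OF assms(1), of "\<lambda>x. frechet_derivative f (at x) v" "\<lambda>x. f' x v" k]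
    by (metis frechet_derivative_at)
  then show ?thesis
    using assms(2) by (auto simp: differentiable_def)
qed

lemma C_on_SucD:
  assumes "C_on (Suc k) S f" "x \<in> S"
  shows "(f has_derivative frechet_derivative f (at x)) (at x)"
  using assms by (simp add: frechet_derivative_works)

lemma C_on_lower: "C_on (Suc k) S f \<Longrightarrow> C_on k S f"
proof (induction k arbitrary: f)
  case 0
  then show ?case
    by (auto intro: continuous_at_imp_continuous_on differentiable_imp_continuous_within)
next
  case (Suc k)
  then show ?case by (metis C_on.simps(2))
qed

lemma C_on_imp_continuous_on: "C_on k S f \<Longrightarrow> continuous_on S f"
  by (induction k) (auto dest: C_on_lower simp del: C_on.simps(2))

lemma C_on_const: "open S \<Longrightarrow> C_on k S (\<lambda>x. c)"
  by (induction k arbitrary: c) (auto intro!: C_on_SucI[where f' = "\<lambda>_ _. 0"] simp del: C_on.simps(2))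

lemma C_on_linear_comp:
  assumes "open S" "bounded_linear h" "C_on k S f"
  shows "C_on k S (\<lambda>x. h (f x))"
  using assms(3)
proof (induction k arbitrary: f)
  case 0
  then show ?case
    using bounded_linear.continuous_on[OF assms(2)] by auto
next
  case (Suc k)
  have "((\<lambda>x. h (f x)) has_derivative (\<lambda>v. h (frechet_derivative f (at x) v))) (at x)" if "x \<in> S" for x
    by (rule bounded_linear.has_derivative[OF assms(2) C_on_SucD[OF Suc.prems that]])
  then show ?case
    using Suc by (intro C_on_SucI[OF assms(1)]) auto
qed

lemma C_on_id: "open S \<Longrightarrow> C_on k S (\<lambda>x. x)"
  by (cases k) (auto intro!: C_on_SucI[where f' = "\<lambda>_ v. v"] C_on_const simp del: C_on.simps(2)
      simp: C_on.simps(1))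

lemma C_on_add:
  assumes "open S" "C_on k S f" "C_on k S g"
  shows "C_on k S (\<lambda>x. f x + g x)"
  using assms(2,3)
proof (induction k arbitrary: f g)
  case 0
  then show ?case by (auto intro!: continuous_on_inverse continuous_on_add continuous_on_mult)
next
  case (Suc k)
  show ?case
    using Suc has_derivative_add[OF C_on_SucD[OF Suc.prems(1)] C_on_SucD[OF Suc.prems(2)]]
    by (intro C_on_SucI[OF assms(1)]) auto
qed

lemma C_on_sum:
  assumes "open S" "\<And>i. i \<in> I \<Longrightarrow> C_on k S (f i)"
  shows "C_on k S (\<lambda>x. \<Sum>i\<in>I. f i x)"
  using assms(2)
  by (induction I rule: infinite_finite_induct) (auto intro: C_on_const C_on_add assms(1))

lemma C_on_mult:
  fixes f g :: "'a::euclidean_space \<Rightarrow> real"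
  assumes "open S" "C_on k S f" "C_on k S g"
  shows "C_on k S (\<lambda>x. f x * g x)"
  using assms(2,3)
proof (induction k arbitrary: f g)
  case 0
  then show ?case by (auto intro!: continuous_on_inverse continuous_on_add continuous_on_mult)
next
  case (Suc k)
  show ?case
    using Suc C_on_lower[OF Suc.prems(1)] C_on_lower[OF Suc.prems(2)]
    by (intro C_on_SucI[OF assms(1) has_derivative_mult[OF C_on_SucD[OF Suc.prems(1)] C_on_SucD[OF Suc.prems(2)]]])
      (auto intro: C_on_add assms(1))
qed

lemma C_on_prod:
  fixes f :: "'i \<Rightarrow> 'a::euclidean_space \<Rightarrow> real"
  assumes "open S" "\<And>i. i \<in> I \<Longrightarrow> C_on k S (f i)"
  shows "C_on k S (\<lambda>x. \<Prod>i\<in>I. f i x)"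
  using assms(2)
  by (induction I rule: infinite_finite_induct) (auto intro: C_on_const C_on_mult assms(1))

lemma C_on_inverse:
  fixes f :: "'a::euclidean_space \<Rightarrow> real"
  assumes "open S" "C_on k S f" "\<And>x. x \<in> S \<Longrightarrow> f x \<noteq> 0"
  shows "C_on k S (\<lambda>x. inverse (f x))"
  using assms(2)
proof (induction k)
  case 0
  then show ?case using assms(3) by (auto intro!: continuous_on_inverse continuous_on_add continuous_on_mult)
next
  case (Suc k)
  have D: "((\<lambda>x. inverse (f x)) has_derivative
      (\<lambda>v. (-1) * (inverse (f x) * frechet_derivative f (at x) v * inverse (f x)))) (at x)"
    if "x \<in> S" for x
    using Deriv.has_derivative_inverse[OF assms(3)[OF that] C_on_SucD[OF Suc.prems that]] by simp
  have "C_on k S (\<lambda>x. inverse (f x))"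
    using Suc C_on_lower by blast
  then show ?case
    by (intro C_on_SucI[OF assms(1) D] C_on_mult C_on_const assms(1)) (use Suc.prems in auto)
qed

lemma C_on_scaleR:
  assumes "open S" "C_on k S f" "C_on k S g"
  shows "C_on k S (\<lambda>x. f x *\<^sub>R g x)"
proof -
  have "C_on k S (\<lambda>x. \<Sum>c\<in>Basis. (f x * (g x \<bullet> c)) *\<^sub>R c)"
    by (intro C_on_sum C_on_mult C_on_linear_comp[OF _ bounded_linear_scaleR_left]
        C_on_linear_comp[OF _ bounded_linear_inner_left] assms)
  then show ?thesis
    by (simp only: scaleR_scaleR[symmetric] scaleR_sum_right[symmetric] euclidean_representation)
qed

text \<open>
  The derivative of \<open>f \<circ> g\<close> is expanded over a basis of the intermediate space, which turns the chain
  rule into sums of products to which the induction hypothesis applies.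
\<close>

lemma C_on_compose:
  assumes "open S" "open T" "g ` S \<subseteq> T" "C_on k T f" "C_on k S g"
  shows "C_on k S (\<lambda>x. f (g x))"
  using assms(4,5)
proof (induction k arbitrary: f)
  case 0
  then show ?case using assms(3) by (auto intro: continuous_on_compose2)
next
  case (Suc k)
  let ?D = "\<lambda>x. frechet_derivative g (at x)"
  have "((\<lambda>x. f (g x)) has_derivative
      (\<lambda>v. \<Sum>b\<in>Basis. (?D x v \<bullet> b) *\<^sub>R frechet_derivative f (at (g x)) b)) (at x)"
    if "x \<in> S" for x
  proof -
    have f: "(f has_derivative frechet_derivative f (at (g x))) (at (g x))"
      using C_on_SucD[OF Suc.prems(1)] assms(3) that by blast
    have lin: "linear (frechet_derivative f (at (g x)))"
      using f has_derivative_linear by blast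
    have "frechet_derivative f (at (g x)) w = (\<Sum>b\<in>Basis. (w \<bullet> b) *\<^sub>R frechet_derivative f (at (g x)) b)" for w
      by (subst (1) euclidean_representation[of w, symmetric]) (simp add: linear_sum[OF lin] linear_cmul[OF lin])
    then show ?thesis
      by (intro has_derivative_eq_rhs[OF has_derivative_compose[OF C_on_SucD[OF Suc.prems(2) that] f]] ext)
  qed
  moreover have "C_on k S (\<lambda>x. \<Sum>b\<in>Basis. (?D x v \<bullet> b) *\<^sub>R frechet_derivative f (at (g x)) b)" for v
  proof (intro C_on_sum assms(1))
    fix b
    have 1: "C_on k S (\<lambda>x. ?D x v \<bullet> b)"
      using Suc.prems(2) by (auto intro: C_on_linear_comp[OF assms(1) bounded_linear_inner_left])
    have 2: "C_on k S (\<lambda>x. frechet_derivative f (at (g x)) b)"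
      using Suc.IH[of "\<lambda>z. frechet_derivative f (at z) b", OF _ C_on_lower[OF Suc.prems(2)]] Suc.prems(1)
      by simp
    show "C_on k S (\<lambda>x. (?D x v \<bullet> b) *\<^sub>R frechet_derivative f (at (g x)) b)"
      by (rule C_on_scaleR[OF assms(1) 1 2])
  qed
  ultimately show ?case by (intro C_on_SucI[OF assms(1)])
qed

lemma C_on_component: "open S \<Longrightarrow> C_on k S f \<Longrightarrow> C_on k S (\<lambda>x. f x $ i)"
  for f :: "'a::euclidean_space \<Rightarrow> real ^ 'n::finite"
  using C_on_linear_comp[OF _ bounded_linear_vec_nth] .

lemma C_on_vecI:
  fixes f :: "'a::euclidean_space \<Rightarrow> real ^ 'n::finite"
  assumes "open S" "\<And>i. C_on k S (\<lambda>x. f x $ i)"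
  shows "C_on k S f"
proof -
  have "C_on k S (\<lambda>x. \<Sum>i\<in>UNIV. f x $ i *\<^sub>R axis i 1)"
    by (intro C_on_sum C_on_linear_comp[OF _ bounded_linear_scaleR_left] assms)
  also have "(\<lambda>x. \<Sum>i\<in>UNIV. f x $ i *\<^sub>R axis i 1) = f"
    unfolding scalar_mult_eq_scaleR[symmetric] basis_expansion ..
  finally show ?thesis .
qed

lemma C_on_det:
  fixes A :: "'a::euclidean_space \<Rightarrow> real ^ 'n::finite ^ 'n"
  assumes "open S" "\<And>i j. C_on k S (\<lambda>x. A x $ i $ j)"
  shows "C_on k S (\<lambda>x. det (A x))"
  unfolding det_def by (intro C_on_sum C_on_mult C_on_prod C_on_const assms)

lemma smooth_on_quad_form: "smooth_on UNIV (quad_form a)"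
proof -
  have "C_on k UNIV (\<lambda>x. \<Sum>i\<in>UNIV. a $ i * (x $ i * x $ i))" for k
    by (intro C_on_sum C_on_mult C_on_const C_on_component C_on_id open_UNIV)
  then show ?thesis
    by (simp add: smooth_on_def quad_form_def[abs_def] power2_eq_square)
qed

section \<open>Null sets: Sard, parallel lines, and matrix pencils\<close>

text \<open>
  The equidimensional Sard theorem \<open>baby_Sard\<close> is stated for index types of class \<^class>\<open>wellorder\<close>.
  It is transferred to an arbitrary finite index type \<open>'n\<close> through a copy of \<open>'n\<close>, well-ordered by
  an injection into the natural numbers.
\<close>

typedef 'n copy = "UNIV :: 'n set" ..

text \<open>
  An arbitrary injection into \<^typ>\<open>nat\<close>; it only serves to order the copy.
\<close>

definition copy_rank :: "'n::finite copy \<Rightarrow> nat" where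
  "copy_rank = (SOME r. inj r)"

lemma inj_copy_rank: "inj (copy_rank :: 'n::finite copy \<Rightarrow> nat)"
proof -
  obtain h :: "'n \<Rightarrow> nat" where "inj h"
    using finite_imp_inj_to_nat_seg[of "UNIV :: 'n set"] by auto
  then have "inj (\<lambda>i. h (Rep_copy i))"
    by (metis (no_types, lifting) Rep_copy_inject inj_def)
  then show ?thesis
    unfolding copy_rank_def by (rule someI[where P = inj])
qed

instantiation copy :: (finite) "{finite, wellorder}"
begin

definition less_eq_copy :: "'a copy \<Rightarrow> 'a copy \<Rightarrow> bool" where
  "i \<le> j \<longleftrightarrow> copy_rank i \<le> copy_rank j"

definition less_copy :: "'a copy \<Rightarrow> 'a copy \<Rightarrow> bool" where
  "i < j \<longleftrightarrow> copy_rank i < copy_rank j"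

instance
proof
  have "(UNIV :: 'a copy set) = Abs_copy ` UNIV"
    by (metis Rep_copy_inverse surj_def)
  then show "finite (UNIV :: 'a copy set)"
    by (metis finite finite_imageI)
next
  fix P :: "'a copy \<Rightarrow> bool" and i :: "'a copy"
  assume "\<And>i. (\<And>j. j < i \<Longrightarrow> P j) \<Longrightarrow> P i"
  then show "P i"
    using measure_induct_rule[of copy_rank P i] unfolding less_copy_def by blast
qed (use inj_copy_rank in \<open>auto simp: less_eq_copy_def less_copy_def inj_def\<close>)

end

lemma card_copy: "CARD('n::finite copy) = CARD('n)"
  by (metis type_definition.card type_definition_copy)

proposition Sard_equidimensional:
  fixes f :: "real ^ 'n::finite \<Rightarrow> real ^ 'n"
  assumes f: "\<And>x. x \<in> S \<Longrightarrow> (f has_derivative f' x) (at x within S)"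
    and ninj: "\<And>x. x \<in> S \<Longrightarrow> \<not> inj (f' x)"
  shows "negligible (f ` S)"
proof -
  define h :: "real ^ 'n \<Rightarrow> real ^ 'n copy" where "h = (\<lambda>x. \<chi> i. x $ Rep_copy i)"
  define k :: "real ^ 'n copy \<Rightarrow> real ^ 'n" where "k = (\<lambda>y. \<chi> i. y $ Abs_copy i)"
  have kh: "k (h x) = x" and hk: "h (k y) = y" for x y
    by (simp_all add: h_def k_def vec_eq_iff Abs_copy_inverse Rep_copy_inverse)
  have h: "bounded_linear h" and k: "bounded_linear k"
    by (auto simp: h_def k_def linear_conv_bounded_linear[symmetric] linear_iff vec_eq_iff)
  have "negligible ((\<lambda>y. h (f (k y))) ` h ` S)"
  proof (rule baby_Sard[where f' = "\<lambda>y v. h (f' (k y) (k v))"])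
    fix y assume y: "y \<in> h ` S"
    then have ky: "k y \<in> S" by (auto simp: kh)
    have "((\<lambda>y. f (k y)) has_derivative (\<lambda>v. f' (k y) (k v))) (at y within h ` S)"
      using f[OF ky] by (intro has_derivative_in_compose[where f = k and g = f])
        (auto intro!: bounded_linear_imp_has_derivative k simp: image_image kh)
    then show D: "((\<lambda>y. h (f (k y))) has_derivative (\<lambda>v. h (f' (k y) (k v)))) (at y within h ` S)"
      by (rule bounded_linear.has_derivative[OF h])
    have lin: "linear (\<lambda>v. h (f' (k y) (k v)))"
      using D has_derivative_linear by blast
    have "\<not> inj (\<lambda>v. h (f' (k y) (k v)))"
    proof
      assume "inj (\<lambda>v. h (f' (k y) (k v)))"
      then have "inj (f' (k y))"
        unfolding inj_def by (metis kh)
      then show False using ninj ky by blast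
    qed
    then show "rank (matrix (\<lambda>v. h (f' (k y) (k v)))) < CARD('n copy)"
      unfolding less_rank_noninjective matrix_vector_mul(2)[OF lin] .
  qed simp
  then have "negligible (k ` (\<lambda>y. h (f (k y))) ` h ` S)"
    by (rule negligible_differentiable_image_negligible[rotated])
      (auto simp: card_copy intro!: bounded_linear_imp_differentiable_on k)
  then show ?thesis
    by (simp add: image_image kh)
qed

text \<open>
  A substitute for Fubini's theorem. If every line parallel to \<open>e\<close> meets \<open>S\<close> in at most \<open>N\<close> points,
  then \<open>M\<close> distinct small translates of a bounded part of \<open>S\<close> along \<open>e\<close> cover no point more than
  \<open>N\<close> times and stay in a fixed ball, so \<open>M\<close> times the measure of that part is bounded in \<open>M\<close>. For
  \<open>e = 0\<close> the hypothesis forces \<open>S\<close> to be empty.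
\<close>

lemma negligible_few_on_parallels:
  fixes e :: "'a::euclidean_space"
  assumes S: "S \<in> sets lebesgue"
    and few: "\<And>x. finite {t::real. x + t *\<^sub>R e \<in> S} \<and> card {t::real. x + t *\<^sub>R e \<in> S} \<le> N"
  shows "negligible S"
proof -
  have "negligible (S \<inter> cbox a b)" for a b
  proof -
    let ?S = "S \<inter> cbox a b"
    have S': "?S \<in> lmeasurable"
      using S by (intro bounded_set_imp_lmeasurable) (auto intro: bounded_subset[OF bounded_cbox])
    obtain R where R: "\<And>x. x \<in> cbox a b \<Longrightarrow> norm x \<le> R"
      using bounded_cbox by (metis bounded_iff)
    define t where "t k = inverse (real (Suc k))" for k
    have t: "\<bar>t k\<bar> \<le> 1" "inj t" for k
      by (auto simp: t_def inj_def field_simps)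
    define T where "T k = (+) (t k *\<^sub>R e) ` ?S" for k
    let ?B = "cball (0::'a) (R + norm e)"
    have T: "T k \<in> lmeasurable" "measure lebesgue (T k) = measure lebesgue ?S" for k
      unfolding T_def by (rule measurable_translation[OF S'] measure_translation)+
    have TB: "T k \<subseteq> ?B" for k
    proof
      fix x assume "x \<in> T k"
      then obtain s where s: "s \<in> cbox a b" "x = t k *\<^sub>R e + s" by (auto simp: T_def)
      have "norm x \<le> \<bar>t k\<bar> * norm e + norm s"
        using norm_triangle_ineq[of "t k *\<^sub>R e" s] s by simp
      also have "\<dots> \<le> 1 * norm e + R"
        using R[OF s(1)] t by (intro add_mono mult_right_mono) auto
      finally show "x \<in> ?B" by simp
    qed
    have "real M * measure lebesgue ?S \<le> real N * measure lebesgue ?B" for M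
    proof -
      have "((\<lambda>x. \<Sum>k<M. indicator (T k) x) has_integral (\<Sum>k<M. measure lebesgue (T k))) UNIV"
        by (intro has_integral_sum) (use T(1) in \<open>auto simp: lmeasurable_iff_has_integral\<close>)
      moreover have "((\<lambda>x. real N * indicator ?B x) has_integral (real N * measure lebesgue ?B)) UNIV"
        by (intro has_integral_mult_right) (simp only: lmeasurable_iff_has_integral[symmetric] lmeasurable_cball)
      moreover have "(\<Sum>k<M. indicator (T k) x) \<le> real N * indicator ?B x" for x
      proof (cases "x \<in> ?B")
        case True
        have "{k. k < M \<and> x \<in> T k} \<subseteq> (\<lambda>k. - t k) -` {t. x + t *\<^sub>R e \<in> S}"
          by (auto simp: T_def)
        moreover have "inj (\<lambda>k. - t k)" using t(2) by (simp add: inj_def)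
        ultimately have "card {k. k < M \<and> x \<in> T k} \<le> card {t. x + t *\<^sub>R e \<in> S}"
          using few[of x] by (intro card_inj_on_le[where f = "\<lambda>k. - t k"]) (auto simp: inj_on_def)
        also have "\<dots> \<le> N" using few by blast
        finally have "card {k. k < M \<and> x \<in> T k} \<le> N" .
        moreover have "(\<Sum>k<M. indicator (T k) x) = real (card ({..<M} \<inter> {k. x \<in> T k}))"
          by (simp add: indicator_def sum.If_cases)
        moreover have "{..<M} \<inter> {k. x \<in> T k} = {k. k < M \<and> x \<in> T k}" by auto
        ultimately show ?thesis using True by simp
      next
        case False
        then have "\<And>k. x \<notin> T k" using TB by blast
        then show ?thesis by simp
      qed
      ultimately have "(\<Sum>k<M. measure lebesgue (T k)) \<le> real N * measure lebesgue ?B"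
        by (rule has_integral_le)
      then show ?thesis by (simp add: T)
    qed
    moreover have "\<exists>M. real N * measure lebesgue ?B < real M * measure lebesgue ?S"
      if "0 < measure lebesgue ?S"
      using reals_Archimedean3[OF that] by blast
    ultimately have "measure lebesgue ?S = 0"
      by (meson measure_nonneg not_le order.antisym)
    then show ?thesis
      using negligible_iff_measure0[OF S'] by blast
  qed
  then show ?thesis
    using negligible_on_intervals by blast
qed

lemma det_pencil_roots:
  fixes A B :: "real ^ 'n::finite ^ 'n"
  assumes "det (A + t0 *\<^sub>R B) \<noteq> 0"
  shows "finite {t. det (A + t *\<^sub>R B) = 0} \<and> card {t. det (A + t *\<^sub>R B) = 0} \<le> CARD('n)"
proof -
  define p :: "real poly" where "p = (\<Sum>\<sigma> | \<sigma> permutes (UNIV::'n set).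
    smult (of_int (sign \<sigma>)) (\<Prod>i\<in>UNIV. [:A $ i $ \<sigma> i, B $ i $ \<sigma> i:]))"
  have p: "poly p t = det (A + t *\<^sub>R B)" for t
    by (simp add: p_def det_def poly_sum poly_prod)
  have "degree (\<Prod>i\<in>UNIV. [:A $ i $ \<sigma> i, B $ i $ \<sigma> i:]) \<le> CARD('n)" for \<sigma>
    by (rule order_trans[OF degree_prod_sum_le]) (auto intro: order_trans[OF sum_bounded_above[where K = 1]])
  then have "degree p \<le> CARD('n)"
    unfolding p_def by (intro degree_sum_le) (auto intro: order_trans[OF degree_smult_le])
  moreover have "p \<noteq> 0" using p[of t0] assms by auto
  ultimately show ?thesis
    using card_poly_roots_bound[of p] poly_roots_finite[of p] by (simp add: p)
qed

text \<open>
  The matrix in the hypothesis is the limit, for large \<open>t\<close>, of \<open>A + t *\<^sub>R B\<close> with the rows in \<open>I\<close>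
  divided by \<open>t\<close>.
\<close>

lemma det_pencil_nonzero:
  fixes A B :: "real ^ 'n::finite ^ 'n"
  assumes "det (\<chi> l. if l \<in> I then B $ l else A $ l) \<noteq> 0" "\<And>l. l \<notin> I \<Longrightarrow> B $ l = 0"
  shows "\<exists>t. det (A + t *\<^sub>R B) \<noteq> 0"
proof -
  \<comment> \<open>For \<open>s > 0\<close> this is \<open>A + (1/s) *\<^sub>R B\<close> with the rows in \<open>I\<close> multiplied by \<open>s\<close>.\<close>
  define R where
    "R s = (\<chi> l. (if l \<in> I then B $ l else A $ l) + s *\<^sub>R (if l \<in> I then A $ l else 0))" for s :: real
  have "isCont (\<lambda>s. det (R s)) 0"
    unfolding det_def by (auto simp: R_def intro!: continuous_intros)
  moreover have "det (R 0) \<noteq> 0"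
    using assms(1) by (simp add: R_def cong: if_cong)
  ultimately obtain d where d: "d > 0" "\<And>s. dist s 0 < d \<Longrightarrow> det (R s) \<noteq> 0"
    using continuous_at_avoid[of 0 "\<lambda>s. det (R s)" 0] by (auto simp: dist_commute)
  define s where "s = d / 2"
  have s: "s > 0" "det (R s) \<noteq> 0" using d by (auto simp: s_def)
  have "R s = (\<chi> l. (if l \<in> I then s else 1) *s (A + inverse s *\<^sub>R B) $ l)"
    using s(1) assms(2) by (simp add: R_def vec_eq_iff field_simps)
  then have "det (R s) = (\<Prod>l\<in>UNIV. if l \<in> I then s else 1) * det (\<chi> l. (A + inverse s *\<^sub>R B) $ l)"
    by (simp only: det_rows_mul)
  then show ?thesis using s(2) by (metis mult_zero_right vec_lambda_eta)
qed

section \<open>Parameters with a degenerate zero form a null set\<close>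

text \<open>
  The matrix \<open>param_Hessian L F Q a z\<close> is the Jacobian matrix at \<open>z\<close> of the map with components
  \<open>F l z + (\<Sum>i\<in>-L. a $ i * Q i l z) + 2 * a $ l * z $ l\<close>, for \<open>l \<in> L\<close>, in the directions of \<open>L\<close>.
  Rows and columns outside \<open>L\<close> are those of the identity matrix, so the determinant is that of the
  \<open>L \<times> L\<close> block. In the application the components are the partial derivatives of \<open>f + q\<^sub>a\<close> in
  a chart of the submanifold with coordinates \<open>x\<^sub>l\<close>, \<open>l \<in> L\<close>, and the block is the transposed
  Hessian matrix.
\<close>

definition param_Hessian :: "'n::finite set \<Rightarrow> ('n \<Rightarrow> real ^ 'n \<Rightarrow> real) \<Rightarrow>
    ('n \<Rightarrow> 'n \<Rightarrow> real ^ 'n \<Rightarrow> real) \<Rightarrow> real ^ 'n \<Rightarrow> real ^ 'n \<Rightarrow> real ^ 'n ^ 'n" where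
  "param_Hessian L F Q a z = (\<chi> l m.
     if l \<in> L \<and> m \<in> L then
       frechet_derivative (F l) (at z) (axis m 1) +
       (\<Sum>i\<in>-L. a $ i * frechet_derivative (Q i l) (at z) (axis m 1)) + (if l = m then 2 * a $ l else 0)
     else if l = m then 1 else 0)"

text \<open>
  Twice the projection onto the coordinates in \<open>I\<close>: the derivative of \<^const>\<open>param_Hessian\<close> in the
  direction of the parameter that is \<open>1\<close> on \<open>I\<close> and \<open>0\<close> elsewhere.
\<close>

definition diag_on :: "'n::finite set \<Rightarrow> real ^ 'n ^ 'n" where
  "diag_on I = (\<chi> l m. if l \<in> I \<and> l = m then 2 else 0)"

lemma param_Hessian_shift:
  assumes "I \<subseteq> L"
  shows "param_Hessian L F Q (a + t *\<^sub>R (\<chi> i. if i \<in> I then 1 else 0)) z =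
         param_Hessian L F Q a z + t *\<^sub>R diag_on I"
proof -
  have "(\<Sum>i\<in>-L. (a $ i + t * (if i \<in> I then 1 else 0)) * c i) = (\<Sum>i\<in>-L. a $ i * c i)" for c
    using assms by (intro sum.cong) auto
  then show ?thesis
    using assms by (auto simp: param_Hessian_def diag_on_def vec_eq_iff)
qed

lemma sum_axis: "(\<Sum>m\<in>UNIV. v $ m *\<^sub>R axis m 1) = v" for v :: "real ^ 'n::finite"
  unfolding scalar_mult_eq_scaleR[symmetric] basis_expansion ..

lemma linear_axis_expand:
  fixes h :: "real ^ 'n::finite \<Rightarrow> 'b::real_vector"
  assumes "linear h" "\<And>m. m \<notin> L \<Longrightarrow> v $ m = 0"
  shows "(\<Sum>m\<in>L. v $ m *\<^sub>R h (axis m 1)) = h v"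
proof -
  have "h v = h (\<Sum>m\<in>UNIV. v $ m *\<^sub>R axis m 1)" by (simp only: sum_axis)
  also have "\<dots> = (\<Sum>m\<in>UNIV. v $ m *\<^sub>R h (axis m 1))"
    using assms(1) by (simp add: linear_sum linear_cmul)
  also have "\<dots> = (\<Sum>m\<in>L. v $ m *\<^sub>R h (axis m 1))"
    by (rule sum.mono_neutral_right) (use assms(2) in auto)
  finally show ?thesis ..
qed

lemma param_Hessian_mult:
  assumes "l \<in> L" "\<And>m. m \<notin> L \<Longrightarrow> v $ m = 0"
    and "linear (frechet_derivative (F l) (at z))" "\<And>i. linear (frechet_derivative (Q i l) (at z))"
  shows "(param_Hessian L F Q a z *v v) $ l =
    frechet_derivative (F l) (at z) v + (\<Sum>i\<in>-L. a $ i * frechet_derivative (Q i l) (at z) v) + 2 * a $ l * v $ l"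
proof -
  let ?h = "\<lambda>w. frechet_derivative (F l) (at z) w + (\<Sum>i\<in>-L. a $ i * frechet_derivative (Q i l) (at z) w) + 2 * a $ l * w $ l"
  have lin: "linear ?h"
    using assms(3,4) by (auto simp: linear_iff algebra_simps sum.distrib sum_distrib_left)
  have "(param_Hessian L F Q a z *v v) $ l = (\<Sum>m\<in>UNIV. param_Hessian L F Q a z $ l $ m * v $ m)"
    by (simp add: matrix_vector_mult_def)
  also have "\<dots> = (\<Sum>m\<in>L. v $ m *\<^sub>R ?h (axis m 1))"
    by (rule sum.mono_neutral_cong_right) (use assms(1,2) in \<open>auto simp: param_Hessian_def axis_def\<close>)
  also have "\<dots> = ?h v"
    by (rule linear_axis_expand[OF lin assms(2)])
  finally show ?thesis .
qed

text \<open>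
  From here to the end of the block, \<open>F\<close> and \<open>Q\<close> are arbitrary families of \<open>C\<^sup>1\<close> functions. The claim
  is that, for almost every \<open>a\<close>, no point of \<open>W\<close> in the coordinate subspace of \<open>L\<close> is a zero of the
  map above at which its \<open>L \<times> L\<close> Jacobian block is singular.
\<close>

context
  fixes W :: "(real ^ 'n::finite) set" and L :: "'n set"
    and F :: "'n \<Rightarrow> real ^ 'n \<Rightarrow> real" and Q :: "'n \<Rightarrow> 'n \<Rightarrow> real ^ 'n \<Rightarrow> real"
  assumes W: "open W"
    and F: "\<And>l. C_on (Suc 0) W (F l)" and Q: "\<And>i l. C_on (Suc 0) W (Q i l)"
begin

lemma param_derivs:
  assumes "z \<in> W"
  shows "(F l has_derivative frechet_derivative (F l) (at z)) (at z)"
    "(Q i l has_derivative frechet_derivative (Q i l) (at z)) (at z)"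
    "linear (frechet_derivative (F l) (at z))" "linear (frechet_derivative (Q i l) (at z))"
  using C_on_SucD[OF F assms] C_on_SucD[OF Q assms] has_derivative_linear by blast+

text \<open>
  The zeros \<open>z\<close> considered here vanish exactly outside \<open>J = L - I\<close>. The parameters having such a zero
  are parametrized by \<open>\<Psi>\<close>: the coordinates of \<open>\<zeta>\<close> in \<open>J\<close> are those of \<open>z\<close>, the remaining ones are
  parameters, and the parameters in \<open>J\<close> are found by solving the equations with index in \<open>J\<close>, which
  is possible because \<open>z $ j \<noteq> 0\<close>. Domain and target both have the dimension of the whole space.

  Row \<open>j \<in> J\<close> of the Jacobian block, restricted to the directions in \<open>J\<close>, is \<open>- 2 * \<zeta> $ j\<close> times that
  row of the derivative of \<open>\<Psi>\<close>. If the \<open>J \<times> J\<close> block is singular, \<open>\<zeta>\<close> is therefore a critical point of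
  \<open>\<Psi>\<close>, and Sard's theorem applies (\<open>E2\<close>). If it is nonsingular, moving all parameters in \<open>I\<close> by
  the same amount \<open>t\<close> changes neither the zero nor that block, while the whole determinant is a
  nonzero polynomial in \<open>t\<close>; so the remaining set (\<open>E1\<close>) meets each of these lines in boundedly
  many points and is negligible, and so is its image.
\<close>

lemma negligible_stratum:
  assumes I: "I \<subseteq> L"
  shows "negligible {a. \<exists>z\<in>W. (\<forall>i. i \<notin> L - I \<longleftrightarrow> z $ i = 0) \<and>
    (\<forall>l\<in>L. F l z + (\<Sum>i\<in>-L. a $ i * Q i l z) + 2 * a $ l * z $ l = 0) \<and>
    det (param_Hessian L F Q a z) = 0}" (is "negligible ?bad")
proof -
  let ?J = "L - I"
  \<comment> \<open>\<open>\<pi> \<zeta>\<close> is the zero encoded by \<open>\<zeta>\<close>, and \<open>N \<zeta> j\<close> is the equation for \<open>j\<close> without its last summand.\<close>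
  define \<pi> :: "real ^ 'n \<Rightarrow> real ^ 'n" where "\<pi> \<zeta> = (\<chi> i. if i \<in> ?J then \<zeta> $ i else 0)" for \<zeta>
  define N where "N \<zeta> j = F j (\<pi> \<zeta>) + (\<Sum>i\<in>-L. \<zeta> $ i * Q i j (\<pi> \<zeta>))" for \<zeta> j
  define \<Psi> :: "real ^ 'n \<Rightarrow> real ^ 'n"
    where "\<Psi> \<zeta> = (\<chi> j. if j \<in> ?J then - N \<zeta> j / (2 * \<zeta> $ j) else \<zeta> $ j)" for \<zeta>
  define D where "D = {\<zeta>. \<pi> \<zeta> \<in> W \<and> (\<forall>j\<in>?J. \<zeta> $ j \<noteq> 0)}"
  define H where "H \<zeta> = param_Hessian L F Q (\<Psi> \<zeta>) (\<pi> \<zeta>)" for \<zeta>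
  \<comment> \<open>\<open>H0\<close> is singular exactly when the \<open>J \<times> J\<close> block of \<open>H\<close> is.\<close>
  define H0 where "H0 \<zeta> = (\<chi> l. if l \<in> I then diag_on I $ l else H \<zeta> $ l)" for \<zeta>
  define DN where "DN \<zeta> j v = frechet_derivative (F j) (at (\<pi> \<zeta>)) (\<pi> v) +
    (\<Sum>i\<in>-L. \<zeta> $ i * frechet_derivative (Q i j) (at (\<pi> \<zeta>)) (\<pi> v) + v $ i * Q i j (\<pi> \<zeta>))" for \<zeta> j v
  define D\<Psi> where "D\<Psi> \<zeta> v = (\<chi> j. if j \<in> ?J then
      (- DN \<zeta> j v * (2 * \<zeta> $ j) + N \<zeta> j * (2 * v $ j)) / ((2 * \<zeta> $ j) * (2 * \<zeta> $ j)) else v $ j)" for \<zeta> v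
  have lin\<pi>: "bounded_linear \<pi>"
    by (auto simp: \<pi>_def linear_conv_bounded_linear[symmetric] linear_iff vec_eq_iff)
  have cont\<pi>: "continuous_on X \<pi>" for X
    by (rule linear_continuous_on[OF lin\<pi>])
  have contW: "continuous_on D (\<lambda>\<zeta>. f (\<pi> \<zeta>))" if "continuous_on W f" for f :: "real ^ 'n \<Rightarrow> real"
    by (rule continuous_on_compose2[OF that cont\<pi>]) (auto simp: D_def)
  have "open D"
  proof -
    have "D = \<pi> -` W \<inter> (\<Inter>j\<in>?J. {\<zeta>. \<zeta> $ j \<noteq> 0})" by (auto simp: D_def)
    moreover have "open (\<pi> -` W)"
      using open_vimage[OF W] cont\<pi> by blast
    moreover have "open {\<zeta>. \<zeta> $ j \<noteq> (0::real)}" for j :: 'n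
      by (intro open_Collect_neq continuous_intros)
    ultimately show ?thesis by (simp add: open_Int open_INT)
  qed
  have der\<Psi>: "(\<Psi> has_derivative D\<Psi> \<zeta>) (at \<zeta>)" if "\<zeta> \<in> D" for \<zeta>
  proof -
    have z: "\<pi> \<zeta> \<in> W" using that by (simp add: D_def)
    note d = has_derivative_compose[OF bounded_linear_imp_has_derivative[OF lin\<pi>]]
    have "((\<lambda>\<zeta>. N \<zeta> j) has_derivative DN \<zeta> j) (at \<zeta>)" for j
      unfolding N_def DN_def[abs_def]
      by (intro has_derivative_add has_derivative_sum has_derivative_mult
          d[OF param_derivs(1)[OF z]] d[OF param_derivs(2)[OF z]]
          bounded_linear_imp_has_derivative bounded_linear_vec_nth)
    then have *: "((\<lambda>\<zeta>. - N \<zeta> j / (2 * \<zeta> $ j)) has_derivative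
      (\<lambda>v. (- DN \<zeta> j v * (2 * \<zeta> $ j) - - N \<zeta> j * (2 * v $ j)) / ((2 * \<zeta> $ j) * (2 * \<zeta> $ j)))) (at \<zeta>)"
      if "j \<in> ?J" for j
      using that \<open>\<zeta> \<in> D\<close>
      by (intro has_derivative_divide' has_derivative_minus has_derivative_mult_right
          bounded_linear_imp_has_derivative bounded_linear_vec_nth) (auto simp: D_def)
    have "((\<lambda>\<zeta>. \<Psi> \<zeta> $ j) has_derivative (\<lambda>v. D\<Psi> \<zeta> v $ j)) (at \<zeta>)" for j
    proof (cases "j \<in> ?J")
      case True
      with *[OF this] show ?thesis by (simp add: \<Psi>_def D\<Psi>_def)
    next
      case False
      then have "(\<lambda>\<zeta>. \<Psi> \<zeta> $ j) = (\<lambda>\<zeta>. \<zeta> $ j)" "(\<lambda>v. D\<Psi> \<zeta> v $ j) = (\<lambda>v. v $ j)"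
        by (auto simp: \<Psi>_def D\<Psi>_def)
      then show ?thesis
        by (simp only: bounded_linear_imp_has_derivative bounded_linear_vec_nth)
    qed
    then show ?thesis
      by (subst has_derivative_componentwise_within) (auto simp: Basis_vec_def inner_axis)
  qed
  have contH: "continuous_on D (\<lambda>\<zeta>. H \<zeta> $ l $ m)" for l m
  proof -
    have cont\<Psi>: "continuous_on D (\<lambda>\<zeta>. \<Psi> \<zeta> $ i)" for i
      using der\<Psi> by (intro continuous_intros continuous_at_imp_continuous_on ballI has_derivative_continuous)
    have "continuous_on D (\<lambda>\<zeta>. frechet_derivative (F l) (at (\<pi> \<zeta>)) (axis m 1))"
      and "\<And>i. continuous_on D (\<lambda>\<zeta>. frechet_derivative (Q i l) (at (\<pi> \<zeta>)) (axis m 1))"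
      using F Q by (auto intro!: contW)
    then show ?thesis
      unfolding H_def param_Hessian_def
      by (cases "l \<in> L \<and> m \<in> L"; cases "l = m") (auto intro!: continuous_intros cont\<Psi>)
  qed
  then have contH0: "continuous_on D (\<lambda>\<zeta>. H0 \<zeta> $ l $ m)" for l m
    by (cases "l \<in> I") (auto simp: H0_def)
  have cdet: "continuous_on D (\<lambda>\<zeta>. det (A \<zeta>))"
    if "\<And>l m. continuous_on D (\<lambda>\<zeta>. A \<zeta> $ l $ m)" for A :: "real ^ 'n \<Rightarrow> real ^ 'n ^ 'n"
    unfolding det_def by (intro continuous_intros that)
  define E1 where "E1 = {\<zeta> \<in> D. det (H \<zeta>) = 0 \<and> det (H0 \<zeta>) \<noteq> 0}"
  define E2 where "E2 = {\<zeta> \<in> D. det (H0 \<zeta>) = 0}"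
  have "negligible (\<Psi> ` E2)"
  proof (rule Sard_equidimensional[where f' = D\<Psi>])
    fix \<zeta> assume "\<zeta> \<in> E2"
    then have \<zeta>: "\<zeta> \<in> D" "det (H0 \<zeta>) = 0" by (auto simp: E2_def)
    show "(\<Psi> has_derivative D\<Psi> \<zeta>) (at \<zeta> within E2)"
      using der\<Psi>[OF \<zeta>(1)] has_derivative_at_withinI by blast
    have z: "\<pi> \<zeta> \<in> W" using \<zeta> by (simp add: D_def)
    obtain v where v: "v \<noteq> 0" "H0 \<zeta> *v v = 0"
      using \<zeta>(2) invertible_det_nz[of "H0 \<zeta>"]
      by (metis invertible_left_inverse matrix_left_invertible_ker)
    \<comment> \<open>Outside \<open>J\<close>, the rows of \<open>H0\<close> are multiples of unit vectors.\<close>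
    have vJ: "v $ l = 0" if "l \<notin> ?J" for l
    proof -
      have "(H0 \<zeta> *v v) $ l = (\<Sum>m\<in>UNIV. H0 \<zeta> $ l $ m * v $ m)"
        by (simp add: matrix_vector_mult_def)
      also have "\<dots> = (\<Sum>m\<in>UNIV. if m = l then (if l \<in> I then 2 else 1) * v $ l else 0)"
        using that I by (intro sum.cong) (auto simp: H0_def H_def diag_on_def param_Hessian_def)
      also have "\<dots> = (if l \<in> I then 2 else 1) * v $ l" by simp
      finally show ?thesis using v(2) by (simp split: if_splits)
    qed
    then have \<pi>v: "\<pi> v = v" by (simp add: \<pi>_def vec_eq_iff)
    have "D\<Psi> \<zeta> v = 0"
    proof (clarsimp simp: vec_eq_iff)
      fix j show "D\<Psi> \<zeta> v $ j = 0"
      proof (cases "j \<in> ?J")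
        case True
        then have "(H \<zeta> *v v) $ j = (H0 \<zeta> *v v) $ j"
          by (simp add: H0_def matrix_vector_mult_def)
        then have "0 = (H \<zeta> *v v) $ j" by (simp add: v(2))
        also have "\<dots> = frechet_derivative (F j) (at (\<pi> \<zeta>)) v +
            (\<Sum>i\<in>-L. \<Psi> \<zeta> $ i * frechet_derivative (Q i j) (at (\<pi> \<zeta>)) v) + 2 * \<Psi> \<zeta> $ j * v $ j"
          unfolding H_def using True vJ param_derivs[OF z] by (intro param_Hessian_mult) auto
        also have "\<dots> = DN \<zeta> j v + 2 * \<Psi> \<zeta> $ j * v $ j"
          using vJ by (simp add: DN_def \<pi>v \<Psi>_def)
        finally have "DN \<zeta> j v = N \<zeta> j / \<zeta> $ j * v $ j"
          using True by (simp add: \<Psi>_def)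
        moreover have "\<zeta> $ j \<noteq> 0" using True \<zeta> by (auto simp: D_def)
        ultimately show ?thesis using True by (simp add: D\<Psi>_def)
      next
        case False
        then show ?thesis using vJ by (auto simp: D\<Psi>_def)
      qed
    qed
    moreover have "linear (D\<Psi> \<zeta>)"
      using der\<Psi>[OF \<zeta>(1)] has_derivative_linear by blast
    ultimately show "\<not> inj (D\<Psi> \<zeta>)"
      using v(1) by (auto simp: linear_injective_0)
  qed
  moreover have "negligible (\<Psi> ` E1)"
  proof (rule negligible_differentiable_image_negligible[OF order_refl])
    show "\<Psi> differentiable_on E1"
      using der\<Psi> by (auto simp: E1_def differentiable_on_def differentiable_def
          intro: has_derivative_at_withinI)
    show "negligible E1"
    proof (rule negligible_few_on_parallels[where e = "\<chi> i. if i \<in> I then 1 else 0" and N = "CARD('n)"])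
      have "open (D \<inter> (\<lambda>\<zeta>. det (H0 \<zeta>)) -` (- {0}))" "open (D \<inter> (\<lambda>\<zeta>. det (H \<zeta>)) -` (- {0}))"
        using \<open>open D\<close> by (auto intro!: continuous_open_preimage cdet contH contH0)
      moreover have "E1 = (D \<inter> (\<lambda>\<zeta>. det (H0 \<zeta>)) -` (- {0})) - (D \<inter> (\<lambda>\<zeta>. det (H \<zeta>)) -` (- {0}))"
        by (auto simp: E1_def)
      ultimately show "E1 \<in> sets lebesgue" by (metis borel_open sets.Diff sets_completionI_sets sets_lborel)
    next
      fix \<zeta> :: "real ^ 'n"
      let ?e = "(\<chi> i. if i \<in> I then 1 else 0) :: real ^ 'n"
      have \<pi>': "\<pi> (\<zeta> + t *\<^sub>R ?e) = \<pi> \<zeta>" for t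
        by (auto simp: \<pi>_def vec_eq_iff)
      have N': "N (\<zeta> + t *\<^sub>R ?e) j = N \<zeta> j" for t j
        using I by (auto simp: N_def \<pi>' intro!: sum.cong)
      have "\<Psi> (\<zeta> + t *\<^sub>R ?e) = \<Psi> \<zeta> + t *\<^sub>R ?e" for t
        by (auto simp: \<Psi>_def N' vec_eq_iff)
      then have H': "H (\<zeta> + t *\<^sub>R ?e) = H \<zeta> + t *\<^sub>R diag_on I" for t
        unfolding H_def by (simp only: \<pi>' param_Hessian_shift[OF I])
      then have H0': "H0 (\<zeta> + t *\<^sub>R ?e) = H0 \<zeta>" for t
        by (auto simp: H0_def diag_on_def vec_eq_iff)
      have sub: "{t. \<zeta> + t *\<^sub>R ?e \<in> E1} \<subseteq> {t. det (H \<zeta> + t *\<^sub>R diag_on I) = 0}"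
        by (auto simp: E1_def H')
      show "finite {t. \<zeta> + t *\<^sub>R ?e \<in> E1} \<and> card {t. \<zeta> + t *\<^sub>R ?e \<in> E1} \<le> CARD('n)"
      proof (cases "det (H0 \<zeta>) = 0")
        case True
        then have "{t. \<zeta> + t *\<^sub>R ?e \<in> E1} = {}" by (simp add: E1_def H0')
        then show ?thesis by simp
      next
        case False
        then obtain t0 where "det (H \<zeta> + t0 *\<^sub>R diag_on I) \<noteq> 0"
          using det_pencil_nonzero[of I "diag_on I" "H \<zeta>"]
          by (auto simp: H0_def diag_on_def vec_eq_iff)
        from det_pencil_roots[OF this] show ?thesis
          using sub by (meson card_mono finite_subset order_trans)
      qed
    qed
  qed
  moreover have "?bad \<subseteq> \<Psi> ` E1 \<union> \<Psi> ` E2"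
  proof
    fix a assume "a \<in> ?bad"
    then obtain z where z: "z \<in> W" "\<And>i. i \<notin> ?J \<longleftrightarrow> z $ i = 0"
      "\<And>l. l \<in> L \<Longrightarrow> F l z + (\<Sum>i\<in>-L. a $ i * Q i l z) + 2 * a $ l * z $ l = 0"
      "det (param_Hessian L F Q a z) = 0" by blast
    define \<zeta> where "\<zeta> = (\<chi> i. if i \<in> ?J then z $ i else a $ i)"
    have \<pi>\<zeta>: "\<pi> \<zeta> = z"
      using z(2) by (auto simp: \<pi>_def \<zeta>_def vec_eq_iff)
    have nz: "z $ j \<noteq> 0" if "j \<in> ?J" for j using z(2) that by blast
    have N: "N \<zeta> j = F j z + (\<Sum>i\<in>-L. a $ i * Q i j z)" for j
      unfolding N_def \<pi>\<zeta> by (intro arg_cong2[where f = "(+)"] sum.cong) (auto simp: \<zeta>_def)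
    have "\<Psi> \<zeta> $ j = a $ j" for j
    proof (cases "j \<in> ?J")
      case True
      then have "- N \<zeta> j = a $ j * (2 * z $ j)" using z(3)[of j] N[of j] by (simp add: algebra_simps)
      then show ?thesis using True nz[OF True] by (simp add: \<Psi>_def \<zeta>_def)
    qed (auto simp: \<Psi>_def \<zeta>_def)
    then have \<Psi>\<zeta>: "\<Psi> \<zeta> = a" by (simp add: vec_eq_iff)
    moreover have "\<zeta> \<in> D" using z(1) nz by (simp add: D_def \<pi>\<zeta>) (simp add: \<zeta>_def)
    moreover have "det (H \<zeta>) = 0" by (simp add: H_def \<pi>\<zeta> \<Psi>\<zeta> z(4))
    ultimately have "\<zeta> \<in> E1 \<union> E2" by (simp add: E1_def E2_def)
    then show "a \<in> \<Psi> ` E1 \<union> \<Psi> ` E2" using \<Psi>\<zeta> by blast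
  qed
  ultimately show ?thesis
    using negligible_subset negligible_Un by blast
qed

lemma negligible_degenerate:
  "negligible {a. \<exists>z\<in>W. (\<forall>i. i \<notin> L \<longrightarrow> z $ i = 0) \<and>
    (\<forall>l\<in>L. F l z + (\<Sum>i\<in>-L. a $ i * Q i l z) + 2 * a $ l * z $ l = 0) \<and>
    det (param_Hessian L F Q a z) = 0}" (is "negligible ?bad")
proof -
  let ?P = "\<lambda>I a. \<exists>z\<in>W. (\<forall>i. i \<notin> L - I \<longleftrightarrow> z $ i = 0) \<and>
    (\<forall>l\<in>L. F l z + (\<Sum>i\<in>-L. a $ i * Q i l z) + 2 * a $ l * z $ l = 0) \<and>
    det (param_Hessian L F Q a z) = 0"
  have "negligible (\<Union>I\<in>Pow L. {a. ?P I a})"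
  proof (rule negligible_Union)
    fix T assume "T \<in> (\<lambda>I. {a. ?P I a}) ` Pow L"
    then obtain I where "I \<subseteq> L" "T = {a. ?P I a}" by (elim imageE PowD[elim_format]) 
    then show "negligible T" by (simp only: negligible_stratum)
  qed simp
  moreover have "?bad \<subseteq> (\<Union>I\<in>Pow L. {a. ?P I a})"
  proof
    fix a assume "a \<in> ?bad"
    then obtain z where z: "z \<in> W" "\<And>i. i \<notin> L \<Longrightarrow> z $ i = 0"
      "\<forall>l\<in>L. F l z + (\<Sum>i\<in>-L. a $ i * Q i l z) + 2 * a $ l * z $ l = 0"
      "det (param_Hessian L F Q a z) = 0" by blast
    have "?P {l\<in>L. z $ l = 0} a"
      using z by (intro bexI[of _ z]) auto
    then show "a \<in> (\<Union>I\<in>Pow L. {a. ?P I a})" by blast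
  qed
  ultimately show ?thesis by (rule negligible_subset)
qed

end

section \<open>Slice charts given by ambient coordinates\<close>

lemma smooth_on_has_derivative:
  assumes "smooth_on S f" "x \<in> S"
  shows "(f has_derivative frechet_derivative f (at x)) (at x)"
  using assms C_on_SucD unfolding smooth_on_def by blast

lemma frechet_derivative_inverse_homeomorphism:
  assumes "homeomorphism U V f g" "open U" "x \<in> U"
    and f: "(f has_derivative f') (at x)" and g: "(g has_derivative g') (at (f x))"
  shows "g' (f' v) = v"
proof -
  have "((\<lambda>y. y) has_derivative (\<lambda>v. g' (f' v))) (at x)"
    by (rule has_derivative_transform_within_open[OF has_derivative_compose[OF f g] assms(2,3)])
      (use assms(1) homeomorphism_apply1 in blast)
  then have "(\<lambda>v. v) = (\<lambda>v. g' (f' v))"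
    using has_derivative_ident has_derivative_unique by blast
  then show ?thesis by metis
qed

lemma slice_chart_simps:
  assumes "slice_chart M K U V \<phi> \<psi>"
  shows "open U" "open V" "homeomorphism U V \<phi> \<psi>" "homeomorphism V U \<psi> \<phi>" "smooth_on U \<phi>" "smooth_on V \<psi>"
    "x \<in> U \<Longrightarrow> \<phi> x \<in> V" "y \<in> V \<Longrightarrow> \<psi> y \<in> U" "x \<in> U \<Longrightarrow> \<psi> (\<phi> x) = x" "y \<in> V \<Longrightarrow> \<phi> (\<psi> y) = y"
    "x \<in> U \<Longrightarrow> \<phi> x \<in> coord_subspace K \<longleftrightarrow> x \<in> M"
proof -
  show h: "open U" "open V" "homeomorphism U V \<phi> \<psi>" "smooth_on U \<phi>" "smooth_on V \<psi>"
    using assms by (auto simp: slice_chart_def)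
  show "homeomorphism V U \<psi> \<phi>" using h(3) homeomorphism_symD by blast
  show "x \<in> U \<Longrightarrow> \<phi> x \<in> V" "y \<in> V \<Longrightarrow> \<psi> y \<in> U" "x \<in> U \<Longrightarrow> \<psi> (\<phi> x) = x" "y \<in> V \<Longrightarrow> \<phi> (\<psi> y) = y"
    using h(3) by (auto simp: homeomorphism_def)
  have eq: "\<phi> ` (M \<inter> U) = V \<inter> coord_subspace K"
    using assms by (simp add: slice_chart_def)
  show "x \<in> U \<Longrightarrow> \<phi> x \<in> coord_subspace K \<longleftrightarrow> x \<in> M"
  proof
    assume x: "x \<in> U" "\<phi> x \<in> coord_subspace K"
    then have "\<phi> x \<in> \<phi> ` (M \<inter> U)" using h(3) eq by (auto simp: homeomorphism_def)
    then obtain x' where "x' \<in> M" "x' \<in> U" "\<phi> x = \<phi> x'" by blast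
    then show "x \<in> M" using homeomorphism_apply1[OF h(3)] x(1) by metis
  next
    assume "x \<in> U" "x \<in> M"
    then show "\<phi> x \<in> coord_subspace K" using eq by blast
  qed
qed

text \<open>
  By Cramer's rule the derivative of the inverse is \<open>X v \<circ> \<Upsilon>\<close> in direction \<open>v\<close>, with a smooth
  field \<open>X v\<close>. Hence \<open>\<Upsilon>\<close> gains one order of differentiability at a time.
\<close>

lemma smooth_on_inverse_map:
  fixes \<Xi> \<Upsilon> :: "real ^ 'n::finite \<Rightarrow> real ^ 'n"
  assumes "open U" "open W" and hom: "homeomorphism U W \<Xi> \<Upsilon>" and "smooth_on U \<Xi>"
    and \<Upsilon>: "\<And>z. z \<in> W \<Longrightarrow> (\<Upsilon> has_derivative \<Upsilon>' z) (at z)"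
  shows "smooth_on W \<Upsilon>"
  unfolding smooth_on_def
proof
  fix k
  define A where "A x = matrix (frechet_derivative \<Xi> (at x))" for x
  define X where "X v x = (\<chi> k. det (\<chi> i j. if j = k then v $ i else A x $ i $ j) / det (A x))" for v x
  have hom': "homeomorphism W U \<Upsilon> \<Xi>" using hom homeomorphism_symD by blast
  have \<Upsilon>U: "\<Upsilon> z \<in> U" if "z \<in> W" for z
    using that hom by (auto simp: homeomorphism_def)
  have \<Xi>: "(\<Xi> has_derivative frechet_derivative \<Xi> (at x)) (at x)" if "x \<in> U" for x
    using smooth_on_has_derivative[OF assms(4) that] .
  have A: "A x *v v = frechet_derivative \<Xi> (at x) v" if "x \<in> U" for x v
    using matrix_vector_mul(2)[OF has_derivative_linear[OF \<Xi>[OF that]]] unfolding A_def by (rule fun_cong)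
  have inv: "A (\<Upsilon> z) *v \<Upsilon>' z v = v" if "z \<in> W" for z v
    unfolding A[OF \<Upsilon>U[OF that]]
    using frechet_derivative_inverse_homeomorphism[OF hom' \<open>open W\<close> that \<Upsilon>[OF that] \<Xi>[OF \<Upsilon>U[OF that]]] .
  have detA: "det (A x) \<noteq> 0" if "x \<in> U" for x
  proof -
    have "\<Xi> x \<in> W" "\<Upsilon> (\<Xi> x) = x" using that hom by (auto simp: homeomorphism_def)
    then have "\<And>v. A x *v \<Upsilon>' (\<Xi> x) v = v" using inv by metis
    then have "surj ((*v) (A x))" by (metis surjI)
    then have "\<exists>B. A x ** B = mat 1" using matrix_right_invertible_surjective by blast
    then show ?thesis using invertible_det_nz invertible_right_inverse by blast
  qed
  have XX: "\<Upsilon>' z v = X v (\<Upsilon> z)" if "z \<in> W" for z v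
    using inv[OF that, of v] cramer[OF detA[OF \<Upsilon>U[OF that]]] unfolding X_def by blast
  have Csmooth: "C_on k U (\<lambda>x. X v x)" for k v
  proof (rule C_on_vecI[OF \<open>open U\<close>])
    fix i
    have A: "C_on k U (\<lambda>x. A x $ i $ j)" for i j
      using assms(4) unfolding smooth_on_def A_def matrix_def
      by (auto intro!: C_on_component[OF \<open>open U\<close>]) (metis C_on.simps(2))
    have "C_on k U (\<lambda>x. det (\<chi> i' j. if j = i then v $ i' else A x $ i' $ j) * inverse (det (A x)))"
    proof (intro C_on_mult C_on_inverse C_on_det \<open>open U\<close> A detA)
      fix i' j
      show "C_on k U (\<lambda>x. (\<chi> i' j. if j = i then v $ i' else A x $ i' $ j) $ i' $ j)"
        by (cases "j = i") (auto intro: A C_on_const \<open>open U\<close>)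
    qed
    then show "C_on k U (\<lambda>x. X v x $ i)"
      by (simp add: X_def field_simps)
  qed
  show "C_on k W \<Upsilon>"
  proof (induction k)
    case 0
    then show ?case using hom by (simp add: homeomorphism_def)
  next
    case (Suc k)
    have "C_on k W (\<lambda>z. X v (\<Upsilon> z))" for v
      by (rule C_on_compose[OF \<open>open W\<close> \<open>open U\<close> _ Csmooth Suc]) (use \<Upsilon>U in blast)
    then have "C_on k W (\<lambda>z. \<Upsilon>' z v)" for v
      using C_on_cong[OF \<open>open W\<close>, of "\<lambda>z. \<Upsilon>' z v" "\<lambda>z. X v (\<Upsilon> z)"] XX by blast
    then show ?case by (intro C_on_SucI[OF \<open>open W\<close> \<Upsilon>])
  qed
qed

text \<open>
  The linear forms \<open>v \<mapsto> T v $ k\<close>, \<open>k \<notin> K\<close>, are independent, so they extend to a basis of the dual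
  space by coordinate forms \<open>v \<mapsto> v $ l\<close>, \<open>l \<in> L\<close>. In other words, some coordinates \<open>L\<close> of the ambient
  space restrict to linear coordinates on the preimage of the subspace of \<open>K\<close>. The forms are
  represented by vectors through the inner product.
\<close>

lemma complementary_coordinates:
  fixes T :: "real ^ 'n::finite \<Rightarrow> real ^ 'n" and K :: "'n set"
  assumes T: "linear T" "inj T"
  obtains L \<sigma> where "bij_betw \<sigma> (-L) (-K)"
    "\<And>v. (\<And>l. l \<in> L \<Longrightarrow> v $ l = 0) \<Longrightarrow> (\<And>i. i \<notin> L \<Longrightarrow> T v $ \<sigma> i = 0) \<Longrightarrow> v = 0"
proof -
  define r where "r i = adjoint T (axis i 1)" for i
  have r: "r i \<bullet> v = T v $ i" for i v
    using adjoint_works[OF T(1), of v "axis i 1"] by (simp add: r_def inner_axis inner_commute)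
  have ladj: "linear (adjoint T)" by (rule adjoint_linear[OF T(1)])
  have injadj: "inj (adjoint T)"
  proof (subst linear_injective_0[OF ladj], intro allI impI)
    fix y assume "adjoint T y = 0"
    then have "T x \<bullet> y = 0" for x using adjoint_works[OF T(1), of x y] by simp
    moreover have "surj T" using T linear_injective_imp_surjective by blast
    ultimately have "y \<bullet> y = 0" by (metis surjD)
    then show "y = 0" by simp
  qed
  define B0 where "B0 = r ` (-K)"
  have axes: "independent ((\<lambda>i. axis i 1 :: real ^ 'n) ` (-K))"
    by (rule independent_mono[OF independent_Basis]) auto
  have "B0 = adjoint T ` (\<lambda>i. axis i 1) ` (-K)" by (auto simp: B0_def r_def)
  then have "independent B0"
    using linear_independent_injective_image[OF ladj axes] inj_on_subset[OF injadj] by auto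
  then obtain B where B: "B0 \<subseteq> B" "B \<subseteq> B0 \<union> Basis" "independent B" "B0 \<union> Basis \<subseteq> span B"
    using maximal_independent_subset_extend[of B0 "B0 \<union> Basis"] by blast
  have "span (span B) = UNIV" using B(4) span_mono[of Basis "span B"] by auto
  then have spB: "span B = UNIV" by (simp only: span_span)
  have "card B = CARD('n)"
    using basis_card_eq_dim[of B UNIV] spB B(3) by simp
  have inj_r: "inj r"
    unfolding r_def using injD[OF injadj] by (intro injI) (metis axis_eq_axis zero_neq_one)
  then have cardB0: "card B0 = card (-K)"
    unfolding B0_def by (meson card_image inj_on_subset subset_UNIV)
  define L where "L = {l. axis l 1 \<in> B - B0}"
  have "B - B0 = (\<lambda>l. axis l 1) ` L"
    using B(2) by (auto simp: L_def Basis_vec_def)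
  then have "card (B - B0) = card L"
    by (simp add: card_image inj_on_def axis_eq_axis)
  moreover have "finite B" using B(3) independent_imp_finite by blast
  moreover have "card (B - B0) = card B - card B0"
    using B(1) \<open>finite B\<close> by (meson card_Diff_subset finite_subset)
  moreover have "card (-K) \<le> CARD('n)" by (intro card_mono) auto
  ultimately have "card (-L) = card (-K)"
    using \<open>card B = CARD('n)\<close> cardB0 card_Diff_subset[of L UNIV]
    by (simp flip: Compl_eq_Diff_UNIV)
  then obtain \<sigma> where \<sigma>: "bij_betw \<sigma> (-L) (-K)"
    using finite_same_card_bij[of "-L" "-K"] by auto
  show thesis
  proof (rule that[OF \<sigma>])
    fix v assume v: "\<And>l. l \<in> L \<Longrightarrow> v $ l = 0" "\<And>i. i \<notin> L \<Longrightarrow> T v $ \<sigma> i = 0"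
    have "b \<bullet> v = 0" if b: "b \<in> B" for b
    proof (cases "b \<in> B0")
      case True
      then obtain k where "k \<in> -K" "b = r k" by (auto simp: B0_def)
      moreover then obtain i where "i \<in> -L" "k = \<sigma> i" using \<sigma> by (auto simp: bij_betw_def)
      ultimately show ?thesis using v(2) by (simp add: r)
    next
      case False
      then obtain l where "b = axis l 1" "l \<in> L"
        using b \<open>B - B0 = (\<lambda>l. axis l 1) ` L\<close> by auto
      then show ?thesis using v(1) by (simp add: inner_axis inner_commute)
    qed
    then have "orthogonal v x" if "x \<in> span B" for x
      using that orthogonal_to_span[of x B v] by (simp add: orthogonal_def inner_commute)
    then show "v = 0" using spB by (metis UNIV_I orthogonal_self)
  qed
qed

text \<open>
  Near each of its points, a submanifold is a graph over some of the coordinates of the ambient space: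
  there is a slice chart whose coordinates along the submanifold are the functions \<open>x\<^sub>l\<close>, \<open>l \<in> L\<close>.
\<close>

lemma coordinate_slice_chart:
  fixes M :: "(real ^ 'n::finite) set"
  assumes sc: "slice_chart M K U V \<phi> \<psi>" and p: "p \<in> U"
  obtains L U' W \<Xi> \<Upsilon> where "p \<in> U'" "slice_chart M L U' W \<Xi> \<Upsilon>"
    "\<And>x l. x \<in> U' \<Longrightarrow> l \<in> L \<Longrightarrow> \<Xi> x $ l = x $ l"
proof -
  note s = slice_chart_simps[OF sc]
  have \<phi>: "(\<phi> has_derivative frechet_derivative \<phi> (at x)) (at x)" if "x \<in> U" for x
    using smooth_on_has_derivative[OF s(5) that] .
  have \<psi>: "(\<psi> has_derivative frechet_derivative \<psi> (at y)) (at y)" if "y \<in> V" for y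
    using smooth_on_has_derivative[OF s(6) that] .
  let ?T = "frechet_derivative \<phi> (at p)"
  have "frechet_derivative \<psi> (at (\<phi> p)) (?T v) = v" for v
    using frechet_derivative_inverse_homeomorphism[OF s(3,1) p \<phi>[OF p] \<psi>[OF s(7)[OF p]]] .
  then have "inj ?T" by (metis injI)
  then obtain L \<sigma> where \<sigma>: "bij_betw \<sigma> (-L) (-K)"
    "\<And>v. (\<And>l. l \<in> L \<Longrightarrow> v $ l = 0) \<Longrightarrow> (\<And>i. i \<notin> L \<Longrightarrow> ?T v $ \<sigma> i = 0) \<Longrightarrow> v = 0"
    using complementary_coordinates[OF has_derivative_linear[OF \<phi>[OF p]]] by metis
  define \<Xi> :: "real ^ 'n \<Rightarrow> real ^ 'n" where "\<Xi> x = (\<chi> i. if i \<in> L then x $ i else \<phi> x $ \<sigma> i)" for x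
  define \<Xi>' :: "real ^ 'n \<Rightarrow> real ^ 'n \<Rightarrow> real ^ 'n"
    where "\<Xi>' x v = (\<chi> i. if i \<in> L then v $ i else frechet_derivative \<phi> (at x) v $ \<sigma> i)" for x v
  have C\<Xi>: "C_on k U \<Xi>" for k
  proof (rule C_on_vecI[OF s(1)])
    fix i show "C_on k U (\<lambda>x. \<Xi> x $ i)"
      using s(5) by (cases "i \<in> L") (auto simp: \<Xi>_def smooth_on_def
          intro: C_on_component s(1) C_on_component[OF s(1) C_on_id[OF s(1)]])
  qed
  have \<Xi>': "(\<Xi> has_derivative \<Xi>' x) (at x)" if "x \<in> U" for x
  proof -
    have "((\<lambda>x. \<Xi> x $ i) has_derivative (\<lambda>v. \<Xi>' x v $ i)) (at x)" for i
      using bounded_linear.has_derivative[OF bounded_linear_vec_nth \<phi>[OF that], of "\<sigma> i"]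
        bounded_linear_imp_has_derivative[OF bounded_linear_vec_nth, of i "at x"]
      by (cases "i \<in> L") (simp_all add: \<Xi>_def \<Xi>'_def)
    then show ?thesis
      by (subst has_derivative_componentwise_within) (auto simp: Basis_vec_def inner_axis)
  qed
  have f: "frechet_derivative \<Xi> (at x) = \<Xi>' x" if "x \<in> U" for x
    using frechet_derivative_at[OF \<Xi>'[OF that]] ..
  have bl: "bounded_linear (\<Xi>' x)" if "x \<in> U" for x
    using \<Xi>'[OF that] has_derivative_bounded_linear by blast
  have "inj (\<Xi>' p)"
    unfolding linear_injective_0[OF bounded_linear.linear[OF bl[OF p]]]
  proof (intro allI impI)
    fix v assume "\<Xi>' p v = 0"
    then have z: "\<Xi>' p v $ i = 0" for i by simp
    show "v = 0"
    proof (rule \<sigma>(2))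
      show "v $ l = 0" if "l \<in> L" for l using z[of l] that by (simp add: \<Xi>'_def)
      show "?T v $ \<sigma> i = 0" if "i \<notin> L" for i using z[of i] that by (simp add: \<Xi>'_def)
    qed
  qed
  then obtain G where G: "linear G" "G \<circ> \<Xi>' p = id"
    using linear_injective_left_inverse[OF bounded_linear.linear[OF bl[OF p]]] by blast
  have contv: "continuous_on U (\<lambda>x. \<Xi>' x v)" for v
  proof -
    have "continuous_on U (\<lambda>x. frechet_derivative \<Xi> (at x) v)"
      using C\<Xi>[of "Suc 0"] by simp
    then show ?thesis by (simp add: f cong: continuous_on_cong)
  qed
  have cont: "continuous_on U (\<lambda>x. Blinfun (\<Xi>' x))"
    by (rule continuous_on_blinfun_componentwise)
      (use contv in \<open>simp add: bl bounded_linear_Blinfun_apply cong: continuous_on_cong\<close>)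
  have blD: "(\<Xi> has_derivative blinfun_apply (Blinfun (\<Xi>' x))) (at x)" if "x \<in> U" for x
    using \<Xi>'[OF that] bl[OF that] by (simp add: bounded_linear_Blinfun_apply)
  have blG: "Blinfun G o\<^sub>L Blinfun (\<Xi>' p) = id_blinfun"
    using G by (intro blinfun_eqI)
      (simp add: bounded_linear_Blinfun_apply bl[OF p] linear_conv_bounded_linear pointfree_idE)
  obtain U' W \<Upsilon> \<Upsilon>' where W: "open U'" "U' \<subseteq> U" "p \<in> U'" "open W" "homeomorphism U' W \<Xi> \<Upsilon>"
    "\<And>z. z \<in> W \<Longrightarrow> (\<Upsilon> has_derivative (\<Upsilon>' z)) (at z)"
    using inverse_function_theorem[OF s(1) blD cont p blG] by metis
  have sm: "smooth_on U' \<Xi>"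
    using C\<Xi> C_on_subset[OF _ W(2)] by (auto simp: smooth_on_def)
  have iff: "\<Xi> x \<in> coord_subspace L \<longleftrightarrow> x \<in> M" if "x \<in> U'" for x
  proof -
    have "\<Xi> x \<in> coord_subspace L \<longleftrightarrow> (\<forall>i\<in>-L. \<phi> x $ \<sigma> i = 0)"
      by (auto simp: \<Xi>_def coord_subspace_def)
    also have "\<dots> \<longleftrightarrow> (\<forall>k\<in>\<sigma> ` (-L). \<phi> x $ k = 0)" by blast
    also have "\<dots> \<longleftrightarrow> \<phi> x \<in> coord_subspace K"
      using \<sigma>(1) by (auto simp: bij_betw_def coord_subspace_def)
    finally show ?thesis using s(11) that W(2) by blast
  qed
  have "\<Xi> ` (M \<inter> U') = W \<inter> coord_subspace L"
    using W(5) iff by (auto simp: homeomorphism_def)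
  then have "slice_chart M L U' W \<Xi> \<Upsilon>"
    using W sm smooth_on_inverse_map[OF W(1,4,5) sm W(6)] by (simp add: slice_chart_def)
  then show thesis
    by (rule that[OF W(3)]) (simp add: \<Xi>_def)
qed

section \<open>Chart independence of nondegeneracy\<close>

lemma partial_deriv_has_derivative:
  assumes "(h has_derivative h') (at y)"
  shows "partial_deriv i h y = h' (axis i 1)"
proof -
  have "((\<lambda>t. y + t *\<^sub>R axis i 1) has_derivative (\<lambda>t. t *\<^sub>R axis i 1)) (at 0)"
    by (auto intro!: derivative_eq_intros)
  moreover have "(h has_derivative h') (at (y + 0 *\<^sub>R axis i 1))"
    using assms by simp
  ultimately have "((\<lambda>t. h (y + t *\<^sub>R axis i 1)) has_derivative (\<lambda>t. h' (t *\<^sub>R axis i 1))) (at 0)"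
    by (rule has_derivative_compose)
  moreover have "h' (t *\<^sub>R axis i 1) = h' (axis i 1) * t" for t
    using has_derivative_linear[OF assms] by (simp add: linear_cmul)
  ultimately show ?thesis
    unfolding partial_deriv_def by (intro DERIV_imp_deriv) (simp add: has_field_derivative_def)
qed

lemma add_axis_in_coord_subspace:
  "y \<in> coord_subspace K \<Longrightarrow> v \<in> coord_subspace K \<Longrightarrow> y + t *\<^sub>R v \<in> coord_subspace K"
  by (simp add: coord_subspace_def)

lemma axis_in_coord_subspace: "i \<in> K \<Longrightarrow> axis i 1 \<in> coord_subspace K"
  by (auto simp: coord_subspace_def axis_def)

lemma eventually_line_in_open:
  fixes y v :: "'a::real_normed_vector"
  assumes "open S" "y \<in> S"
  shows "\<forall>\<^sub>F t in nhds (0::real). y + t *\<^sub>R v \<in> S"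
proof -
  have "open ((\<lambda>t. y + t *\<^sub>R v) -` S)"
    by (intro open_vimage[OF assms(1)] continuous_intros)
  then show ?thesis
    using assms(2) by (auto simp: eventually_nhds)
qed

lemma partial_deriv_cong_slice:
  assumes "open S" "y \<in> S \<inter> coord_subspace K" "i \<in> K"
    and "\<And>x. x \<in> S \<inter> coord_subspace K \<Longrightarrow> h x = h' x"
  shows "partial_deriv i h y = partial_deriv i h' y"
  unfolding partial_deriv_def
proof (rule deriv_cong_ev)
  have "\<forall>\<^sub>F t in nhds 0. y + t *\<^sub>R axis i 1 \<in> S"
    using assms(1,2) by (intro eventually_line_in_open) auto
  then show "\<forall>\<^sub>F t in nhds 0. h (y + t *\<^sub>R axis i 1) = h' (y + t *\<^sub>R axis i 1)"
    by (rule eventually_mono)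
      (use assms(2-4) in \<open>auto simp: add_axis_in_coord_subspace axis_in_coord_subspace\<close>)
qed simp

lemma derivative_in_coord_subspace:
  assumes f: "(f has_derivative f') (at y)" and "open S" "y \<in> S" "y \<in> coord_subspace K"
    and v: "v \<in> coord_subspace K"
    and maps: "\<And>x. x \<in> S \<Longrightarrow> x \<in> coord_subspace K \<Longrightarrow> f x \<in> coord_subspace L"
  shows "f' v \<in> coord_subspace L"
  unfolding coord_subspace_def
proof (clarify)
  fix i assume i: "i \<notin> L"
  have "((\<lambda>t. y + t *\<^sub>R v) has_derivative (\<lambda>t. t *\<^sub>R v)) (at 0)"
    by (auto intro!: derivative_eq_intros)
  moreover have "(f has_derivative f') (at (y + 0 *\<^sub>R v))"
    using f by simp
  ultimately have "((\<lambda>t. f (y + t *\<^sub>R v)) has_derivative (\<lambda>t. f' (t *\<^sub>R v))) (at 0)"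
    by (rule has_derivative_compose)
  then have "((\<lambda>t. f (y + t *\<^sub>R v) $ i) has_derivative (\<lambda>t. f' (t *\<^sub>R v) $ i)) (at 0)"
    by (rule bounded_linear.has_derivative[OF bounded_linear_vec_nth])
  moreover have "\<forall>\<^sub>F t in at 0. f (y + t *\<^sub>R v) $ i = 0"
    using eventually_line_in_open[OF \<open>open S\<close> \<open>y \<in> S\<close>, of v] unfolding eventually_at_filter
  proof (rule eventually_mono)
    fix t assume "y + t *\<^sub>R v \<in> S"
    then show "t \<noteq> 0 \<longrightarrow> t \<in> UNIV \<longrightarrow> f (y + t *\<^sub>R v) $ i = 0"
      using maps[of "y + t *\<^sub>R v"] add_axis_in_coord_subspace[OF assms(4) v] i
      by (auto simp: coord_subspace_def)
  qed
  moreover have "f (y + 0 *\<^sub>R v) $ i = 0"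
    using maps assms(3,4) i by (auto simp: coord_subspace_def)
  ultimately have "((\<lambda>t. 0) has_derivative (\<lambda>t. f' (t *\<^sub>R v) $ i)) (at (0::real))"
    by (rule has_derivative_transform_eventually) simp
  then have "(\<lambda>t. f' (t *\<^sub>R v) $ i) = (\<lambda>t. 0)"
    using has_derivative_unique has_derivative_const by blast
  then have "f' (1 *\<^sub>R v) $ i = 0" by metis
  then show "f' v $ i = 0" by simp
qed

lemma linear_axis_expand_subspace:
  fixes h :: "real ^ 'n::finite \<Rightarrow> real"
  assumes "linear h" "v \<in> coord_subspace L"
  shows "h v = (\<Sum>l\<in>L. v $ l * h (axis l 1))"
  using linear_axis_expand[OF assms(1), of L v] assms(2) by (simp add: coord_subspace_def)

text \<open>
  On the coordinate subspace, \<open>\<partial>\<^sub>j (g \<circ> \<psi>) = (\<Sum>l\<in>L. T\<^sub>l\<^sub>j * (\<partial>\<^sub>l (g \<circ> \<Upsilon>) \<circ> \<tau>))\<close>, where \<open>\<tau> = \<Xi> \<circ> \<psi>\<close> is the change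
  of charts and \<open>T\<close> its derivative; only \<open>l \<in> L\<close> occurs because \<open>\<tau>\<close> maps one subspace to the other.
  At a critical point the second factors vanish, so differentiating once more produces no second
  derivatives of \<open>\<tau>\<close>, and the two Hessian matrices are congruent. Symmetry of the Hessian is not needed.
\<close>

lemma nondegenerate_chart_change:
  fixes M :: "(real ^ 'n::finite) set" and g :: "real ^ 'n \<Rightarrow> real"
  assumes A: "slice_chart M K U V \<phi> \<psi>" and B: "slice_chart M L U' W \<Xi> \<Upsilon>"
    and p: "p \<in> M" "p \<in> U" "p \<in> U'" and g: "smooth_on UNIV g"
    and crit: "critical_point K (g \<circ> \<psi>) (\<phi> p)"
  shows "critical_point L (g \<circ> \<Upsilon>) (\<Xi> p)"
    and "nonsingular_Hessian L (g \<circ> \<Upsilon>) (\<Xi> p) \<Longrightarrow> nonsingular_Hessian K (g \<circ> \<psi>) (\<phi> p)"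
proof -
  note a = slice_chart_simps[OF A] and b = slice_chart_simps[OF B]
  let ?y = "\<phi> p" and ?z = "\<Xi> p"
  have cont: "continuous_on V \<psi>" "continuous_on W \<Upsilon>"
    using a(3) b(3) by (auto simp: homeomorphism_def)
  define V1 where "V1 = V \<inter> \<psi> -` U'"
  define W1 where "W1 = W \<inter> \<Upsilon> -` U"
  have V1: "open V1" "?y \<in> V1" and W1: "open W1" "?z \<in> W1"
    using p a(2,7,9) b(2,7,9) continuous_open_preimage[OF cont(1) a(2) b(1)]
      continuous_open_preimage[OF cont(2) b(2) a(1)] by (auto simp: V1_def W1_def)
  define \<tau> where "\<tau> y = \<Xi> (\<psi> y)" for y
  define \<rho> where "\<rho> z = \<phi> (\<Upsilon> z)" for z
  have homeo: "homeomorphism V1 W1 \<tau> \<rho>"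
  proof -
    have "continuous_on V1 \<tau>" unfolding \<tau>_def
      by (rule continuous_on_compose2[of U' \<Xi>]) (use b(3) cont in \<open>auto simp: V1_def homeomorphism_def intro: continuous_on_subset\<close>)
    moreover have "continuous_on W1 \<rho>" unfolding \<rho>_def
      by (rule continuous_on_compose2[of U \<phi>]) (use a(3) cont in \<open>auto simp: W1_def homeomorphism_def intro: continuous_on_subset\<close>)
    ultimately show ?thesis
      by (intro homeomorphismI) (auto simp: V1_def W1_def \<tau>_def \<rho>_def a b)
  qed
  have C\<tau>: "C_on k V1 \<tau>" and C\<rho>: "C_on k W1 \<rho>" for k
  proof -
    show "C_on k V1 \<tau>" unfolding \<tau>_def
      by (rule C_on_compose[OF V1(1) b(1)])
        (use a(6) b(5) C_on_subset[of k V \<psi> V1] in \<open>auto simp: smooth_on_def V1_def\<close>)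
    show "C_on k W1 \<rho>" unfolding \<rho>_def
      by (rule C_on_compose[OF W1(1) a(1)])
        (use b(6) a(5) C_on_subset[of k W \<Upsilon> W1] in \<open>auto simp: smooth_on_def W1_def\<close>)
  qed
  define T where "T y = frechet_derivative \<tau> (at y)" for y
  define R where "R z = frechet_derivative \<rho> (at z)" for z
  have T: "(\<tau> has_derivative T y) (at y)" if "y \<in> V1" for y
    using C_on_SucD[OF C\<tau> that] by (simp add: T_def)
  have R: "(\<rho> has_derivative R z) (at z)" if "z \<in> W1" for z
    using C_on_SucD[OF C\<rho> that] by (simp add: R_def)
  have \<tau>y: "\<tau> ?y = ?z" and \<rho>z: "\<rho> ?z = ?y"
    using p a b by (auto simp: \<tau>_def \<rho>_def)
  have RT: "R ?z (T ?y v) = v" and TR: "T ?y (R ?z v) = v" for v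
    using frechet_derivative_inverse_homeomorphism[OF homeo V1 T[OF V1(2)]] R[OF W1(2)]
      frechet_derivative_inverse_homeomorphism[OF homeomorphism_symD[OF homeo] W1 R[OF W1(2)]] T[OF V1(2)]
    by (simp_all add: \<tau>y \<rho>z)
  have \<tau>L: "\<tau> y \<in> coord_subspace L" if "y \<in> V1" "y \<in> coord_subspace K" for y
    using that a(8,10,11) b(11) by (auto simp: V1_def \<tau>_def) metis
  have \<rho>K: "\<rho> z \<in> coord_subspace K" if "z \<in> W1" "z \<in> coord_subspace L" for z
    using that b(8,10,11) a(11) by (auto simp: W1_def \<rho>_def) metis
  have yK: "?y \<in> coord_subspace K" and zL: "?z \<in> coord_subspace L"
    using p a(11) b(11) by auto
  have TL: "T y v \<in> coord_subspace L" if "y \<in> V1" "y \<in> coord_subspace K" "v \<in> coord_subspace K" for y v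
    by (rule derivative_in_coord_subspace[OF T[OF that(1)] V1(1) that]) (use \<tau>L in blast)
  have RK: "R ?z v \<in> coord_subspace K" if "v \<in> coord_subspace L" for v
    by (rule derivative_in_coord_subspace[OF R[OF W1(2)] W1 zL that]) (use \<rho>K in blast)
  define h where "h = g \<circ> \<Upsilon>"
  have Ch: "C_on k W h" for k
    unfolding h_def o_def by (rule C_on_compose[OF b(2) open_UNIV])
      (use g b(6) in \<open>auto simp: smooth_on_def\<close>)
  have h: "(h has_derivative frechet_derivative h (at z)) (at z)" if "z \<in> W" for z
    using C_on_SucD[OF Ch that] .
  define G where "G l z = frechet_derivative h (at z) (axis l 1)" for l z
  have CG: "C_on k W (G l)" for k l
    using Ch[of "Suc k"] by (simp add: G_def[abs_def])
  have G: "(G l has_derivative frechet_derivative (G l) (at z)) (at z)" if "z \<in> W" for z l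
    using C_on_SucD[OF CG that] .
  have \<tau>W: "\<tau> y \<in> W" if "y \<in> V1" for y
    using that b(7) by (auto simp: V1_def \<tau>_def)
  have zW: "?z \<in> W" using \<tau>W[OF V1(2)] by (simp add: \<tau>y)
  have comp: "g (\<psi> y) = h (\<tau> y)" if "y \<in> V1" for y
    using that b(9) by (auto simp: V1_def \<tau>_def h_def)
  have der: "((g \<circ> \<psi>) has_derivative (\<lambda>v. frechet_derivative h (at (\<tau> y)) (T y v))) (at y)" if "y \<in> V1" for y
    by (rule has_derivative_transform_within_open[OF has_derivative_compose[OF T[OF that] h[OF \<tau>W[OF that]]] V1(1) that])
      (simp add: comp)
  \<comment> \<open>The formula holds on the coordinate subspace only, but differentiates along it only.\<close>
  have pd: "partial_deriv j (g \<circ> \<psi>) y = (\<Sum>l\<in>L. T y (axis j 1) $ l * G l (\<tau> y))"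
    if "y \<in> V1 \<inter> coord_subspace K" "j \<in> K" for y j
  proof -
    have "partial_deriv j (g \<circ> \<psi>) y = frechet_derivative h (at (\<tau> y)) (T y (axis j 1))"
      using that by (intro partial_deriv_has_derivative der) simp
    also have "\<dots> = (\<Sum>l\<in>L. T y (axis j 1) $ l * G l (\<tau> y))"
      unfolding G_def using that
      by (intro linear_axis_expand_subspace TL axis_in_coord_subspace has_derivative_linear[OF h] \<tau>W) auto
    finally show ?thesis .
  qed
  have G0: "G l ?z = 0" if "l \<in> L" for l
  proof -
    let ?u = "R ?z (axis l 1)"
    have u: "?u \<in> coord_subspace K" using RK axis_in_coord_subspace that by blast
    have "G l ?z = frechet_derivative h (at (\<tau> ?y)) (T ?y ?u)"
      by (simp add: G_def TR \<tau>y)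
    also have "\<dots> = (\<Sum>i\<in>K. ?u $ i * frechet_derivative h (at (\<tau> ?y)) (T ?y (axis i 1)))"
      by (rule linear_axis_expand_subspace[OF has_derivative_linear[OF der[OF V1(2)]] u])
    also have "\<dots> = 0"
      using crit partial_deriv_has_derivative[OF der[OF V1(2)]] by (simp add: critical_point_def)
    finally show ?thesis .
  qed
  have hpd: "partial_deriv l h z = G l z" if "z \<in> W" for l z
    unfolding G_def by (rule partial_deriv_has_derivative[OF h[OF that]])
  show "critical_point L (g \<circ> \<Upsilon>) (\<Xi> p)"
    using G0 hpd[OF zW] by (simp add: critical_point_def h_def)
  have hess_h: "partial_deriv m (partial_deriv l h) ?z = frechet_derivative (G l) (at ?z) (axis m 1)" for l m
  proof -
    have "partial_deriv m (partial_deriv l h) ?z = partial_deriv m (G l) ?z"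
      using hpd zW b(2) by (intro partial_deriv_cong_slice[where K = UNIV and S = W]) (auto simp: coord_subspace_def)
    then show ?thesis using partial_deriv_has_derivative[OF G[OF zW]] by simp
  qed
  have hess: "partial_deriv i (partial_deriv j (g \<circ> \<psi>)) ?y =
      (\<Sum>l\<in>L. T ?y (axis j 1) $ l * frechet_derivative (G l) (at ?z) (T ?y (axis i 1)))"
    if "i \<in> K" "j \<in> K" for i j
  proof -
    let ?P = "\<lambda>y. \<Sum>l\<in>L. T y (axis j 1) $ l * G l (\<tau> y)"
    have "partial_deriv i (partial_deriv j (g \<circ> \<psi>)) ?y = partial_deriv i ?P ?y"
      using pd that V1 yK by (intro partial_deriv_cong_slice[where K = K and S = V1]) auto
    also have "\<dots> = (\<Sum>l\<in>L. T ?y (axis j 1) $ l * frechet_derivative (G l) (at ?z) (T ?y (axis i 1)))"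
    proof -
      have "C_on (Suc 0) V1 (\<lambda>y. T y (axis j 1) $ l)" for l
        using C\<tau>[of "Suc (Suc 0)"] unfolding T_def by (intro C_on_component V1(1)) (metis C_on.simps(2))
      note CT = C_on_SucD[OF this V1(2)]
      have Gz: "((\<lambda>y. G l (\<tau> y)) has_derivative (\<lambda>v. frechet_derivative (G l) (at ?z) (T ?y v))) (at ?y)" for l
        using has_derivative_compose[OF T[OF V1(2)], of "G l"] G[OF zW] by (simp add: \<tau>y)
      have "(?P has_derivative (\<lambda>v. \<Sum>l\<in>L. T ?y (axis j 1) $ l * frechet_derivative (G l) (at ?z) (T ?y v) +
          frechet_derivative (\<lambda>y. T y (axis j 1) $ l) (at ?y) v * G l (\<tau> ?y))) (at ?y)"
        by (intro has_derivative_sum has_derivative_mult CT Gz)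
      from partial_deriv_has_derivative[OF this] show ?thesis
        by (simp add: \<tau>y G0)
    qed
    finally show ?thesis .
  qed
  assume ns: "nonsingular_Hessian L (g \<circ> \<Upsilon>) (\<Xi> p)"
  show "nonsingular_Hessian K (g \<circ> \<psi>) (\<phi> p)"
    unfolding nonsingular_Hessian_def
  proof (intro ballI impI)
    fix v assume v: "v \<in> coord_subspace K"
      and ker: "\<forall>i\<in>K. (\<Sum>j\<in>K. partial_deriv i (partial_deriv j (g \<circ> \<psi>)) ?y * v $ j) = 0"
    define w where "w = T ?y v"
    have w: "w \<in> coord_subspace L" using TL[OF V1(2) yK v] by (simp add: w_def)
    \<comment> \<open>The second Hessian form paired with \<open>w\<close>: it vanishes on all axes in \<open>K\<close>, hence on the preimages of
      the axes in \<open>L\<close>.\<close>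
    define B where "B u = (\<Sum>l\<in>L. w $ l * frechet_derivative (G l) (at ?z) (T ?y u))" for u
    have linG: "linear (frechet_derivative (G l) (at ?z))" for l
      using has_derivative_linear[OF G[OF zW]] .
    have linT: "linear (T ?y)" using has_derivative_linear[OF T[OF V1(2)]] .
    have linB: "linear B"
      unfolding B_def using linG linT by (auto simp: linear_iff sum.distrib algebra_simps sum_distrib_left)
    have "B (axis i 1) = 0" if i: "i \<in> K" for i
    proof -
      have wl: "w $ l = (\<Sum>j\<in>K. v $ j * T ?y (axis j 1) $ l)" for l
        unfolding w_def using v linT
        by (intro linear_axis_expand_subspace[of "\<lambda>v. T ?y v $ l"]) (auto simp: linear_iff)
      have "B (axis i 1) = (\<Sum>l\<in>L. \<Sum>j\<in>K. v $ j * T ?y (axis j 1) $ l * frechet_derivative (G l) (at ?z) (T ?y (axis i 1)))"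
        unfolding B_def wl by (simp add: sum_distrib_right)
      also have "\<dots> = (\<Sum>j\<in>K. \<Sum>l\<in>L. v $ j * T ?y (axis j 1) $ l * frechet_derivative (G l) (at ?z) (T ?y (axis i 1)))"
        by (rule sum.swap)
      also have "\<dots> = (\<Sum>j\<in>K. partial_deriv i (partial_deriv j (g \<circ> \<psi>)) ?y * v $ j)"
        by (intro sum.cong refl) (simp add: hess i sum_distrib_right sum_distrib_left algebra_simps)
      finally show ?thesis using ker i by simp
    qed
    then have B0: "B u = 0" if "u \<in> coord_subspace K" for u
      using linear_axis_expand_subspace[OF linB that] by simp
    have "(\<Sum>l\<in>L. partial_deriv m (partial_deriv l h) ?z * w $ l) = 0" if "m \<in> L" for m
      using B0[OF RK[OF axis_in_coord_subspace[OF that]]] by (simp add: B_def TR hess_h mult.commute)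
    then have "w = 0"
      using ns w unfolding nonsingular_Hessian_def h_def by blast
    then have "R ?z (T ?y v) = 0"
      unfolding w_def[symmetric] using has_derivative_linear[OF R[OF W1(2)]] linear_0 by simp
    then show "v = 0" by (simp add: RT)
  qed
qed

section \<open>Generic quadratic perturbations\<close>

text \<open>
  The partial derivative of \<open>g \<circ> \<Upsilon>\<close> with respect to the \<open>l\<close>-th coordinate.
\<close>

definition chart_grad :: "(real ^ 'n::finite \<Rightarrow> real ^ 'n) \<Rightarrow> (real ^ 'n \<Rightarrow> real) \<Rightarrow> 'n \<Rightarrow> real ^ 'n \<Rightarrow> real" where
  "chart_grad \<Upsilon> g l z = frechet_derivative (\<lambda>z. g (\<Upsilon> z)) (at z) (axis l 1)"

lemma closed_coord_subspace: "closed (coord_subspace K)"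
proof -
  have "coord_subspace K = (\<Inter>i\<in>-K. {y. y $ i = 0})"
    by (auto simp: coord_subspace_def)
  then show ?thesis by (auto intro!: closed_INT closed_Collect_eq continuous_intros)
qed

text \<open>
  The next block fixes a slice chart with coordinates \<open>x\<^sub>l\<close>, \<open>l \<in> L\<close>. In it, \<open>h a\<close> represents \<open>f + q\<^sub>a\<close>, and
  \<open>F l\<close> and \<open>Q i l\<close> are the \<open>l\<close>-th partial derivatives of the functions representing \<open>f\<close> and \<open>x\<^sub>i\<^sup>2\<close>.
\<close>

context
  fixes M :: "(real ^ 'n::finite) set" and L U W \<Xi> \<Upsilon> and f :: "real ^ 'n \<Rightarrow> real"
  assumes chart: "slice_chart M L U W \<Xi> \<Upsilon>"
    and coord: "\<And>x l. x \<in> U \<Longrightarrow> l \<in> L \<Longrightarrow> \<Xi> x $ l = x $ l"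
    and f: "smooth_on UNIV f"
begin

private abbreviation (input) F where "F \<equiv> chart_grad \<Upsilon> f"
private abbreviation (input) Q where "Q \<equiv> \<lambda>i. chart_grad \<Upsilon> (\<lambda>x. (x $ i)\<^sup>2)"
private abbreviation (input) h where "h \<equiv> \<lambda>a z. f (\<Upsilon> z) + quad_form a (\<Upsilon> z)"

lemma C_on_chart_grad:
  assumes "smooth_on UNIV g"
  shows "C_on k W (\<lambda>z. g (\<Upsilon> z))" "C_on k W (chart_grad \<Upsilon> g l)"
proof -
  show *: "C_on k W (\<lambda>z. g (\<Upsilon> z))" for k
    by (rule C_on_compose[OF slice_chart_simps(2)[OF chart] open_UNIV])
      (use assms slice_chart_simps(6)[OF chart] in \<open>auto simp: smooth_on_def\<close>)
  show "C_on k W (chart_grad \<Upsilon> g l)"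
    using *[of "Suc k"] by (simp add: chart_grad_def[abs_def])
qed

lemma smooth_on_square: "smooth_on UNIV (\<lambda>x :: real ^ 'n. (x $ i)\<^sup>2)"
  unfolding smooth_on_def power2_eq_square
  by (intro allI C_on_mult C_on_component C_on_id open_UNIV)

lemma chart_coord: "z \<in> W \<Longrightarrow> l \<in> L \<Longrightarrow> \<Upsilon> z $ l = z $ l"
  using coord[of "\<Upsilon> z" l] slice_chart_simps(8,10)[OF chart] by simp

text \<open>
  Only the squares \<open>x\<^sub>i\<^sup>2\<close> with \<open>i \<notin> L\<close> depend on the chart: for \<open>i \<in> L\<close> they are \<open>z\<^sub>i\<^sup>2\<close>.
\<close>

lemma partial_deriv_perturbed:
  assumes z: "z \<in> W" and l: "l \<in> L"
  shows "partial_deriv l (h a) z = F l z + (\<Sum>i\<in>-L. a $ i * Q i l z) + 2 * a $ l * z $ l"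
proof -
  have W: "open W" using slice_chart_simps(2)[OF chart] .
  have split: "quad_form a (\<Upsilon> z) = (\<Sum>i\<in>-L. a $ i * (\<Upsilon> z $ i)\<^sup>2) + (\<Sum>i\<in>L. a $ i * (z $ i)\<^sup>2)"
    if "z \<in> W" for z
  proof -
    have "quad_form a (\<Upsilon> z) = (\<Sum>i\<in>-L. a $ i * (\<Upsilon> z $ i)\<^sup>2) + (\<Sum>i\<in>L. a $ i * (\<Upsilon> z $ i)\<^sup>2)"
      unfolding quad_form_def by (subst sum.union_disjoint[symmetric]) (auto simp: Un_commute)
    then show ?thesis using chart_coord[OF that] by simp
  qed
  have d: "((\<lambda>z. g (\<Upsilon> z)) has_derivative frechet_derivative (\<lambda>z. g (\<Upsilon> z)) (at z)) (at z)"
    if "smooth_on UNIV g" for g :: "real ^ 'n \<Rightarrow> real"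
    using C_on_SucD[OF C_on_chart_grad(1)[OF that] z] .
  let ?h = "\<lambda>z. f (\<Upsilon> z) + ((\<Sum>i\<in>-L. a $ i * (\<Upsilon> z $ i)\<^sup>2) + (\<Sum>i\<in>L. a $ i * (z $ i)\<^sup>2))"
  have "(?h has_derivative (\<lambda>v. frechet_derivative (\<lambda>z. f (\<Upsilon> z)) (at z) v +
      ((\<Sum>i\<in>-L. a $ i * frechet_derivative (\<lambda>z. (\<Upsilon> z $ i)\<^sup>2) (at z) v) +
       (\<Sum>i\<in>L. a $ i * (2 * (v $ i * z $ i)))))) (at z)"
    by (intro has_derivative_add has_derivative_sum has_derivative_mult_right d f smooth_on_square)
      (auto intro!: derivative_eq_intros bounded_linear_imp_has_derivative bounded_linear_vec_nth)
  from has_derivative_transform_within_open[OF this W z]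
  have "(h a has_derivative (\<lambda>v. frechet_derivative (\<lambda>z. f (\<Upsilon> z)) (at z) v +
      ((\<Sum>i\<in>-L. a $ i * frechet_derivative (\<lambda>z. (\<Upsilon> z $ i)\<^sup>2) (at z) v) +
       (\<Sum>i\<in>L. a $ i * (2 * (v $ i * z $ i)))))) (at z)"
    using split by simp
  from partial_deriv_has_derivative[OF this, of l]
  have "partial_deriv l (h a) z = F l z + ((\<Sum>i\<in>-L. a $ i * Q i l z) + (\<Sum>i\<in>L. a $ i * (2 * (axis l 1 $ i * z $ i))))"
    by (simp add: chart_grad_def)
  also have "(\<Sum>i\<in>L. a $ i * (2 * (axis l 1 $ i * z $ i))) = (\<Sum>i\<in>L. if i = l then 2 * a $ l * z $ l else 0)"
    by (intro sum.cong) (auto simp: axis_def)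
  also have "\<dots> = 2 * a $ l * z $ l"
    using l by simp
  finally show ?thesis by simp
qed

lemma chart_grad_derivs:
  assumes "z \<in> W"
  shows "(F l has_derivative frechet_derivative (F l) (at z)) (at z)"
    "(Q i l has_derivative frechet_derivative (Q i l) (at z)) (at z)"
  using C_on_SucD[OF C_on_chart_grad(2)[OF f] assms] C_on_SucD[OF C_on_chart_grad(2)[OF smooth_on_square] assms]
  by blast+

lemma nonsingular_Hessian_perturbed:
  assumes z: "z \<in> W" and det: "det (param_Hessian L F Q a z) \<noteq> 0"
  shows "nonsingular_Hessian L (h a) z"
  unfolding nonsingular_Hessian_def
proof (intro ballI impI)
  fix v assume v: "v \<in> coord_subspace L"
    and ker: "\<forall>m\<in>L. (\<Sum>l\<in>L. partial_deriv m (partial_deriv l (h a)) z * v $ l) = 0"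
  let ?H = "param_Hessian L F Q a z"
  have second: "partial_deriv m (partial_deriv l (h a)) z = ?H $ l $ m" if "l \<in> L" "m \<in> L" for l m
  proof -
    have "partial_deriv m (partial_deriv l (h a)) z =
        partial_deriv m (\<lambda>z. F l z + (\<Sum>i\<in>-L. a $ i * Q i l z) + 2 * a $ l * z $ l) z"
      by (rule partial_deriv_cong_slice[where K = UNIV and S = W])
        (use slice_chart_simps(2)[OF chart] z that partial_deriv_perturbed in \<open>auto simp: coord_subspace_def\<close>)
    also have "\<dots> = frechet_derivative (F l) (at z) (axis m 1) +
        (\<Sum>i\<in>-L. a $ i * frechet_derivative (Q i l) (at z) (axis m 1)) + 2 * a $ l * axis m 1 $ l"
      by (rule partial_deriv_has_derivative)
        (intro has_derivative_add has_derivative_sum has_derivative_mult_right chart_grad_derivs[OF z]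
          bounded_linear_imp_has_derivative bounded_linear_vec_nth)
    also have "\<dots> = ?H $ l $ m"
      using that by (simp add: param_Hessian_def axis_def)
    finally show ?thesis .
  qed
  have "(transpose ?H *v v) $ m = 0" for m
  proof -
    have "(transpose ?H *v v) $ m = (\<Sum>l\<in>UNIV. ?H $ l $ m * v $ l)"
      by (simp add: matrix_vector_mult_def transpose_def)
    also have "\<dots> = (\<Sum>l\<in>L. ?H $ l $ m * v $ l)"
      by (rule sum.mono_neutral_right) (use v in \<open>auto simp: coord_subspace_def\<close>)
    also have "\<dots> = 0"
    proof (cases "m \<in> L")
      case True
      then show ?thesis using ker second by simp
    next
      case False
      then show ?thesis by (intro sum.neutral) (auto simp: param_Hessian_def)
    qed
    finally show ?thesis .
  qed
  then have "transpose ?H *v v = 0" by (simp add: vec_eq_iff)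
  moreover have "det (transpose ?H) \<noteq> 0" using det by simp
  ultimately show "v = 0"
    by (metis invertible_det_nz invertible_left_inverse matrix_left_invertible_ker)
qed

text \<open>
  The parameters \<open>a\<close> for which the restriction of \<open>f + q\<^sub>a\<close> has a degenerate critical point in \<open>C\<close>,
  expressed in the chart.
\<close>

definition degenerate_params :: "(real ^ 'n) set \<Rightarrow> (real ^ 'n) set" where
  "degenerate_params C = {a. \<exists>x\<in>C.
     (\<forall>l\<in>L. F l (\<Xi> x) + (\<Sum>i\<in>-L. a $ i * Q i l (\<Xi> x)) + 2 * a $ l * \<Xi> x $ l = 0) \<and>
     det (param_Hessian L F Q a (\<Xi> x)) = 0}"

lemma negligible_degenerate_params:
  assumes "C \<subseteq> M \<inter> U"
  shows "negligible (degenerate_params C)"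
proof (rule negligible_subset[OF negligible_degenerate[of W F Q L]])
  show "open W" using slice_chart_simps(2)[OF chart] .
  show "C_on (Suc 0) W (F l)" "C_on (Suc 0) W (Q i l)" for i l
    by (intro C_on_chart_grad f smooth_on_square)+
  show "degenerate_params C \<subseteq> {a. \<exists>z\<in>W. (\<forall>i. i \<notin> L \<longrightarrow> z $ i = 0) \<and>
    (\<forall>l\<in>L. F l z + (\<Sum>i\<in>-L. a $ i * Q i l z) + 2 * a $ l * z $ l = 0) \<and>
    det (param_Hessian L F Q a z) = 0}"
  proof
    fix a assume "a \<in> degenerate_params C"
    then obtain x where x: "x \<in> C" and
      "(\<forall>l\<in>L. F l (\<Xi> x) + (\<Sum>i\<in>-L. a $ i * Q i l (\<Xi> x)) + 2 * a $ l * \<Xi> x $ l = 0) \<and>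
       det (param_Hessian L F Q a (\<Xi> x)) = 0"
      by (auto simp: degenerate_params_def)
    moreover have "\<Xi> x \<in> W" "\<Xi> x \<in> coord_subspace L"
      using slice_chart_simps(7,11)[OF chart, of x] x assms by auto
    ultimately show "a \<in> {a. \<exists>z\<in>W. (\<forall>i. i \<notin> L \<longrightarrow> z $ i = 0) \<and>
      (\<forall>l\<in>L. F l z + (\<Sum>i\<in>-L. a $ i * Q i l z) + 2 * a $ l * z $ l = 0) \<and>
      det (param_Hessian L F Q a z) = 0}"
      by (auto simp: coord_subspace_def intro!: bexI[of _ "\<Xi> x"])
  qed
qed

lemma closed_degenerate_params:
  assumes C: "compact C" "C \<subseteq> U"
  shows "closed (degenerate_params C)"
proof -
  let ?Z = "\<Xi> ` C" and ?P = "\<Xi> ` C \<times> (UNIV :: (real ^ 'n) set)"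
  have homeo: "homeomorphism U W \<Xi> \<Upsilon>" using slice_chart_simps(3)[OF chart] .
  have Z: "compact ?Z"
    using homeo C by (intro compact_continuous_image) (auto simp: homeomorphism_def intro: continuous_on_subset)
  have ZW: "?Z \<subseteq> W" using homeo C by (auto simp: homeomorphism_def)
  let ?crit = "\<lambda>l p. F l (fst p) + (\<Sum>i\<in>-L. snd p $ i * Q i l (fst p)) + 2 * snd p $ l * fst p $ l"
  let ?det = "\<lambda>p. det (param_Hessian L F Q (snd p) (fst p))"
  have fst: "continuous_on ?P (\<lambda>p. g (fst p))" if "continuous_on W g" for g :: "real ^ 'n \<Rightarrow> real"
    by (rule continuous_on_compose2[OF that]) (use ZW in \<open>auto intro: continuous_intros\<close>)
  have 0: "continuous_on W (F l)" "continuous_on W (Q i l)" for i l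
    by (intro C_on_imp_continuous_on[of 0] C_on_chart_grad f smooth_on_square)+
  have 1: "continuous_on W (\<lambda>z. frechet_derivative (F l) (at z) v)"
    "continuous_on W (\<lambda>z. frechet_derivative (Q i l) (at z) v)" for i l v
    using C_on_chart_grad(2)[OF f, of "Suc 0"] C_on_chart_grad(2)[OF smooth_on_square, of "Suc 0"] by simp_all
  have ccrit: "continuous_on ?P (?crit l)" for l
    by (intro continuous_intros fst 0)
  have centry: "continuous_on ?P (\<lambda>p. param_Hessian L F Q (snd p) (fst p) $ l $ m)" for l m
    unfolding param_Hessian_def
    by (cases "l \<in> L \<and> m \<in> L"; cases "l = m") (auto intro!: continuous_intros fst 1)
  have cdet: "continuous_on ?P ?det"
    unfolding det_def by (intro continuous_intros centry)
  have P: "closed ?P" by (rule closed_Times[OF compact_imp_closed[OF Z] closed_UNIV])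
  define T where "T = (\<Inter>l\<in>L. ?P \<inter> ?crit l -` {0}) \<inter> (?P \<inter> ?det -` {0})"
  have "closed T"
    unfolding T_def by (intro closed_Int closed_INT ballI continuous_closed_preimage ccrit cdet P closed_singleton)
  then have "closed {a. \<exists>z. z \<in> ?Z \<and> (z, a) \<in> T}"
    by (rule closed_compact_projection[OF Z])
  also have "{a. \<exists>z. z \<in> ?Z \<and> (z, a) \<in> T} = degenerate_params C"
    by (auto simp: T_def degenerate_params_def)
  finally show ?thesis .
qed

lemma nonsingular_in_every_chart:
  assumes a: "a \<notin> degenerate_params C" and p: "p \<in> C" "C \<subseteq> M \<inter> U" "p \<in> U'"
    and other: "slice_chart M K U' V \<phi> \<psi>"
    and crit: "critical_point K ((\<lambda>x. f x + quad_form a x) \<circ> \<psi>) (\<phi> p)"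
    and smooth: "smooth_on UNIV (\<lambda>x. f x + quad_form a x)"
  shows "nonsingular_Hessian K ((\<lambda>x. f x + quad_form a x) \<circ> \<psi>) (\<phi> p)"
proof -
  have pM: "p \<in> M" "p \<in> U" using p by auto
  have z: "\<Xi> p \<in> W" using slice_chart_simps(7)[OF chart] pM by blast
  note change = nondegenerate_chart_change[OF other chart pM(1) p(3) pM(2) smooth crit]
  have "\<forall>l\<in>L. partial_deriv l (h a) (\<Xi> p) = 0"
    using change(1) by (simp add: critical_point_def o_def)
  then have "det (param_Hessian L F Q a (\<Xi> p)) \<noteq> 0"
    using a p(1) partial_deriv_perturbed[OF z] by (auto simp: degenerate_params_def)
  then have "nonsingular_Hessian L (h a) (\<Xi> p)"
    by (rule nonsingular_Hessian_perturbed[OF z])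
  then show ?thesis by (intro change(2)) (simp add: o_def)
qed

end

lemma closure_Compl_negligible_closed:
  assumes "closed S" "negligible S"
  shows "open (-S)" "closure (-S) = UNIV"
proof -
  show "open (-S)" using assms by blast
  have "interior S = {}"
    using assms(2) open_not_negligible negligible_subset[OF assms(2) interior_subset] open_interior by blast
  then show "closure (-S) = UNIV" by (simp add: closure_complement)
qed

lemma locally_generic_Morse:
  fixes f :: "real ^ 'n::finite \<Rightarrow> real"
  assumes f: "smooth_on UNIV f" and M: "smooth_submanifold M" and p: "p \<in> M"
  shows "\<exists>r>0. \<exists>G. open G \<and> closure G = UNIV \<and>
    (\<forall>a\<in>G. \<forall>q\<in>M \<inter> ball p r. \<forall>K U V \<phi> \<psi>. q \<in> U \<and> slice_chart M K U V \<phi> \<psi> \<and>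
       critical_point K ((\<lambda>x. f x + quad_form a x) \<circ> \<psi>) (\<phi> q) \<longrightarrow>
       nonsingular_Hessian K ((\<lambda>x. f x + quad_form a x) \<circ> \<psi>) (\<phi> q))"
proof -
  obtain K U0 V \<phi> \<psi> where "p \<in> U0" "slice_chart M K U0 V \<phi> \<psi>"
    using M p unfolding smooth_submanifold_def by metis
  then obtain L U W \<Xi> \<Upsilon> where chart: "p \<in> U" "slice_chart M L U W \<Xi> \<Upsilon>"
    "\<And>x l. x \<in> U \<Longrightarrow> l \<in> L \<Longrightarrow> \<Xi> x $ l = x $ l"
    using coordinate_slice_chart by metis
  note s = slice_chart_simps[OF chart(2)]
  obtain r where r: "r > 0" "cball p r \<subseteq> U"
    using s(1) chart(1) open_contains_cball by metis
  define C where "C = M \<inter> cball p r"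
  have "C = cball p r \<inter> \<Xi> -` coord_subspace L"
    using s(11) r by (auto simp: C_def)
  moreover have "closed (cball p r \<inter> \<Xi> -` coord_subspace L)"
    using s(3) r(2) by (intro continuous_closed_preimage closed_coord_subspace)
      (auto simp: homeomorphism_def intro: continuous_on_subset)
  ultimately have "closed C" by simp
  then have "compact C"
    using compact_Int_closed[OF compact_cball, of C p r] by (simp add: C_def Int_ac)
  define B where "B = degenerate_params L \<Xi> \<Upsilon> f C"
  have C: "C \<subseteq> M \<inter> U" "C \<subseteq> U" using r by (auto simp: C_def)
  have B: "closed B" "negligible B"
    unfolding B_def
    using closed_degenerate_params[OF chart(2,3) f \<open>compact C\<close> C(2)]
      negligible_degenerate_params[OF chart(2,3) f C(1)] by auto
  have smooth: "smooth_on UNIV (\<lambda>x. f x + quad_form a x)" for a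
    using f smooth_on_quad_form[of a] by (auto simp: smooth_on_def intro: C_on_add)
  have "nonsingular_Hessian K ((\<lambda>x. f x + quad_form a x) \<circ> \<psi>) (\<phi> q)"
    if "a \<in> -B" "q \<in> M \<inter> ball p r" "q \<in> U'" "slice_chart M K U' V \<phi> \<psi>"
      "critical_point K ((\<lambda>x. f x + quad_form a x) \<circ> \<psi>) (\<phi> q)" for a q K U' V \<phi> \<psi>
    using nonsingular_in_every_chart[OF chart(2,3) f _ _ C(1) that(3,4,5) smooth] that(1,2)
    by (auto simp: B_def C_def)
  then show ?thesis
    using r(1) closure_Compl_negligible_closed[OF B] by (intro exI[of _ r] exI[of _ "-B"] conjI) blast+
qed

theorem theorem4:
  fixes f :: "real ^ 'n::finite \<Rightarrow> real" and M :: "(real ^ 'n) set"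
  assumes "smooth_on UNIV f" and "smooth_submanifold M"
  shows "residual {a :: real ^ 'n. Morse_on M (\<lambda>x. f x + quad_form a x)}"
proof -
  let ?nd = "\<lambda>a q. \<forall>K U V \<phi> \<psi>. q \<in> U \<and> slice_chart M K U V \<phi> \<psi> \<and>
       critical_point K ((\<lambda>x. f x + quad_form a x) \<circ> \<psi>) (\<phi> q) \<longrightarrow>
       nonsingular_Hessian K ((\<lambda>x. f x + quad_form a x) \<circ> \<psi>) (\<phi> q)"
  define good where "good q = {a. ?nd a q}" for q
  have "\<exists>r>0. \<exists>G. open G \<and> closure G = UNIV \<and> (\<forall>a\<in>G. \<forall>q\<in>M \<inter> ball p r. a \<in> good q)"
    if "p \<in> M" for p
    using locally_generic_Morse[OF assms that] unfolding good_def mem_Collect_eq .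
  then obtain r G where r: "\<And>p. p \<in> M \<Longrightarrow> r p > 0"
    and G: "\<And>p. p \<in> M \<Longrightarrow> open (G p) \<and> closure (G p) = UNIV"
    and good: "\<And>p a q. p \<in> M \<Longrightarrow> a \<in> G p \<Longrightarrow> q \<in> M \<inter> ball p (r p) \<Longrightarrow> a \<in> good q"
    by metis
  obtain \<B> where \<B>: "\<B> \<subseteq> (\<lambda>p. ball p (r p)) ` M" "countable \<B>"
    "\<Union>\<B> = (\<Union>p\<in>M. ball p (r p))"
    by (rule Lindelof[of "(\<lambda>p. ball p (r p)) ` M"]) auto
  then obtain N where N: "N \<subseteq> M" "countable N" "\<B> = (\<lambda>p. ball p (r p)) ` N"
    using countable_subset_image[of \<B> "\<lambda>p. ball p (r p)" M] by blast
  have "Morse_on M (\<lambda>x. f x + quad_form a x)" if a: "a \<in> \<Inter>(G ` N)" for a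
    unfolding Morse_on_def
  proof (intro conjI ballI)
    have "smooth_on UNIV (\<lambda>x. f x + quad_form a x)"
      using assms(1) smooth_on_quad_form[of a] by (auto simp: smooth_on_def intro: C_on_add)
    then show "smooth_on_submanifold M (\<lambda>x. f x + quad_form a x)"
      unfolding smooth_on_submanifold_def by (metis UNIV_I open_UNIV)
  next
    fix q assume q: "q \<in> M"
    then have "q \<in> ball q (r q)" using r by simp
    then have "q \<in> \<Union>\<B>" using \<B>(3) q by blast
    then obtain p where "p \<in> N" "q \<in> ball p (r p)" using N(3) by blast
    then have "a \<in> good q" using good[of p a q] a N(1) q by blast
    then show "?nd a q" unfolding good_def by (rule CollectD)
  qed
  then show ?thesis
    unfolding residual_def using N(1,2) G
    by (intro exI[of _ "G ` N"]) (auto intro: countable_image)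
qed

end
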